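(* Let $m,n,l\ge 1$ be integers, let $\mathcal X=\{\mathbf x^{(1)},\dots,\mathbf x^{(l)}\}$ with $\mathbf x^{(i)}\in\mathbb R^n$ and $\mathcal Y=\{\mathbf y^{(1)},\dots,\mathbf y^{(l)}\}$ with $\mathbf y^{(i)}\in\mathbb R^m$, $1\le i\le l$, be given, and let $\beta>0$, $s\in\mathbb R$ and $c_3>0$ be real numbers. With $A_t^{(i_1,i_2)},C_t^{(i_1)},Z_t$ and $\psi_*(\mathcal X,\mathcal Y,\beta,s,c_3,t)=\mathbb E\,Z_t^{c_3}$ as defined in the context, for every $t\in[0,1]$ $$\psi_*(\mathcal X,\mathcal Y,\beta,s,c_3,t)=\psi_*(\mathcal X,\mathcal Y,\beta,s,c_3,0)+\int_0^t\frac{d\psi_*(\mathcal X,\mathcal Y,\beta,s,c_3,\tau)}{d\tau}\,d\tau,$$ where, for $\tau\in(0,1)$, $$\frac{d\psi_*(\mathcal X,\mathcal Y,\beta,s,c_3,\tau)}{d\tau}=-\frac{s^2\beta^2c_3(1-c_3)}{2}\,\mathbb E\sum_{i_1=1}^{l}\sum_{p_1=1}^{l}\frac{(C_\tau^{(i_1)})^{s}(C_\tau^{(p_1)})^{s}\left(\|\mathbf x^{(i_1)}\|_2\|\mathbf x^{(p_1)}\|_2-(\mathbf x^{(i_1)})^T\mathbf x^{(p_1)}\right)}{Z_\tau^{2-c_3}}\left(\sum_{i_2=1}^{l}\sum_{p_2=1}^{l}\frac{A_\tau^{(i_1,i_2)}A_\tau^{(p_1,p_2)}}{C_\tau^{(i_1)}C_\tau^{(p_1)}}\left(\|\mathbf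 y^{(i_2)}\|_2\|\mathbf y^{(p_2)}\|_2-(\mathbf y^{(i_2)})^T\mathbf y^{(p_2)}\right)\right).$$
   Context: $G\in\mathbb R^{m\times n}$, $u^{(4)}\in\mathbb R$, $\mathbf u^{(2)}\in\mathbb R^m$, $\mathbf h\in\mathbb R^n$ have i.i.d. standard normal components and are independent of each other; $\mathbb E$ is expectation over all of them. For $t\in[0,1]$ and $1\le i_1,i_2\le l$ set $$H_t^{(i_1,i_2)}=\sqrt t\,(\mathbf y^{(i_2)})^TG\mathbf x^{(i_1)}+\sqrt{1-t}\,\|\mathbf x^{(i_1)}\|_2(\mathbf y^{(i_2)})^T\mathbf u^{(2)}+\sqrt t\,\|\mathbf x^{(i_1)}\|_2\|\mathbf y^{(i_2)}\|_2\,u^{(4)}+\sqrt{1-t}\,\|\mathbf y^{(i_2)}\|_2\,\mathbf h^T\mathbf x^{(i_1)},$$ $$A_t^{(i_1,i_2)}=e^{\beta H_t^{(i_1,i_2)}},\qquad C_t^{(i_1)}=\sum_{i_2=1}^{l}A_t^{(i_1,i_2)},\qquad Z_t=\sum_{i_1=1}^{l}(C_t^{(i_1)})^{s},$$ $$\psi_*(\mathcal X,\mathcal Y,\beta,s,c_3,t)=\mathbb E\,Z_t^{c_3}=\mathbb E\left(\sum_{i_1=1}^{l}\left(\sum_{i_2=1}^{l}e^{\beta H_t^{(i_1,i_2)}}\right)^{s}\right)^{c_3}.$$ *)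

theory Defs
  imports "HOL-Probability.Probability"
begin

text \<open>
  The dimensions \<open>m, n \<ge> 1\<close> are the cardinalities of the finite index types \<open>'m\<close> and \<open>'n\<close>.
  The set members \<open>x\<^sup>(\<^sup>i\<^sup>)\<close>, \<open>y\<^sup>(\<^sup>i\<^sup>)\<close> are given as families \<open>x i\<close>, \<open>y i\<close>, of which only the
  values at \<open>i \<in> {1..l}\<close> are used.
\<close>

text \<open>
  One index for each scalar entry of \<open>(G, u\<^sup>(\<^sup>4\<^sup>), u\<^sup>(\<^sup>2\<^sup>), h)\<close>, so that joint independence of all
  these entries is independence of a single family.
\<close>

datatype ('m, 'n) coord = Coord_G 'm 'n | Coord_u4 | Coord_u2 'm | Coord_h 'n

fun entry ::
  "('w \<Rightarrow> real^'n^'m) \<Rightarrow> ('w \<Rightarrow> real) \<Rightarrow> ('w \<Rightarrow> real^'m) \<Rightarrow> ('w \<Rightarrow> real^'n)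
    \<Rightarrow> ('m::finite, 'n::finite) coord \<Rightarrow> 'w \<Rightarrow> real" where
  "entry G u4 u2 h (Coord_G i j) = (\<lambda>\<omega>. G \<omega> $ i $ j)"
| "entry G u4 u2 h Coord_u4 = u4"
| "entry G u4 u2 h (Coord_u2 i) = (\<lambda>\<omega>. u2 \<omega> $ i)"
| "entry G u4 u2 h (Coord_h j) = (\<lambda>\<omega>. h \<omega> $ j)"

definition iid_std_normal ::
  "'w measure \<Rightarrow> ('w \<Rightarrow> real^'n^'m) \<Rightarrow> ('w \<Rightarrow> real) \<Rightarrow> ('w \<Rightarrow> real^'m) \<Rightarrow> ('w \<Rightarrow> real^'n) \<Rightarrow> bool"
  where
  "iid_std_normal M G u4 u2 h \<longleftrightarrow>
     prob_space M \<and>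
     prob_space.indep_vars M (\<lambda>_. borel) (entry G u4 u2 h) UNIV \<and>
     (\<forall>k. distributed M lborel (entry G u4 u2 h k) std_normal_density)"

text \<open>In the next four definitions \<open>G, u4, u2, h\<close> are realizations, not random variables.\<close>

definition H_interp ::
  "(nat \<Rightarrow> real^'n) \<Rightarrow> (nat \<Rightarrow> real^'m) \<Rightarrow> real^'n^'m \<Rightarrow> real \<Rightarrow> real^'m \<Rightarrow> real^'n
    \<Rightarrow> real \<Rightarrow> nat \<Rightarrow> nat \<Rightarrow> real" where
  "H_interp x y G u4 u2 h t i1 i2 =
     sqrt t * (y i2 \<bullet> (G *v x i1))
     + sqrt (1 - t) * norm (x i1) * (y i2 \<bullet> u2)
     + sqrt t * norm (x i1) * norm (y i2) * u4
     + sqrt (1 - t) * norm (y i2) * (h \<bullet> x i1)"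

definition A_interp ::
  "(nat \<Rightarrow> real^'n) \<Rightarrow> (nat \<Rightarrow> real^'m) \<Rightarrow> real \<Rightarrow> real^'n^'m \<Rightarrow> real \<Rightarrow> real^'m \<Rightarrow> real^'n
    \<Rightarrow> real \<Rightarrow> nat \<Rightarrow> nat \<Rightarrow> real" where
  "A_interp x y \<beta> G u4 u2 h t i1 i2 = exp (\<beta> * H_interp x y G u4 u2 h t i1 i2)"

definition C_interp ::
  "nat \<Rightarrow> (nat \<Rightarrow> real^'n) \<Rightarrow> (nat \<Rightarrow> real^'m) \<Rightarrow> real
    \<Rightarrow> real^'n^'m \<Rightarrow> real \<Rightarrow> real^'m \<Rightarrow> real^'n \<Rightarrow> real \<Rightarrow> nat \<Rightarrow> real" where
  "C_interp l x y \<beta> G u4 u2 h t i1 = (\<Sum>i2 = 1..l. A_interp x y \<beta> G u4 u2 h t i1 i2)"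

definition Z_interp ::
  "nat \<Rightarrow> (nat \<Rightarrow> real^'n) \<Rightarrow> (nat \<Rightarrow> real^'m) \<Rightarrow> real \<Rightarrow> real
    \<Rightarrow> real^'n^'m \<Rightarrow> real \<Rightarrow> real^'m \<Rightarrow> real^'n \<Rightarrow> real \<Rightarrow> real" where
  "Z_interp l x y \<beta> s G u4 u2 h t = (\<Sum>i1 = 1..l. C_interp l x y \<beta> G u4 u2 h t i1 powr s)"

definition psi_star ::
  "'w measure \<Rightarrow> ('w \<Rightarrow> real^'n^'m) \<Rightarrow> ('w \<Rightarrow> real) \<Rightarrow> ('w \<Rightarrow> real^'m) \<Rightarrow> ('w \<Rightarrow> real^'n)
    \<Rightarrow> nat \<Rightarrow> (nat \<Rightarrow> real^'n) \<Rightarrow> (nat \<Rightarrow> real^'m) \<Rightarrow> real \<Rightarrow> real \<Rightarrow> real \<Rightarrow> real \<Rightarrow> real" where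
  "psi_star M G u4 u2 h l x y \<beta> s c3 t =
     (LINT \<omega>|M. Z_interp l x y \<beta> s (G \<omega>) (u4 \<omega>) (u2 \<omega>) (h \<omega>) t powr c3)"

text \<open>
  The random double sum whose expectation is the derivative of \<^const>\<open>psi_star\<close> up to the factor
  \<open>- s\<^sup>2 \<beta>\<^sup>2 c\<^sub>3 (1 - c\<^sub>3) / 2\<close>; again \<open>G, u4, u2, h\<close> are realizations.
\<close>

definition overlap_sum ::
  "nat \<Rightarrow> (nat \<Rightarrow> real^'n) \<Rightarrow> (nat \<Rightarrow> real^'m) \<Rightarrow> real \<Rightarrow> real \<Rightarrow> real
    \<Rightarrow> real^'n^'m \<Rightarrow> real \<Rightarrow> real^'m \<Rightarrow> real^'n \<Rightarrow> real \<Rightarrow> real" where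
  "overlap_sum l x y \<beta> s c3 G u4 u2 h \<tau> =
     (let A = A_interp x y \<beta> G u4 u2 h \<tau>;
          C = C_interp l x y \<beta> G u4 u2 h \<tau>;
          Z = Z_interp l x y \<beta> s G u4 u2 h \<tau>
      in \<Sum>i1 = 1..l. \<Sum>p1 = 1..l.
           C i1 powr s * C p1 powr s * (norm (x i1) * norm (x p1) - x i1 \<bullet> x p1) / Z powr (2 - c3)
           * (\<Sum>i2 = 1..l. \<Sum>p2 = 1..l.
                A i1 i2 * A p1 p2 / (C i1 * C p1) * (norm (y i2) * norm (y p2) - y i2 \<bullet> y p2)))"

end

theory Submission
  imports Defs "HOL-Real_Asymp.Real_Asymp"
begin

text \<open>
  Substituting \<open>t = sin\<^sup>2 \<theta>\<close> turns the interpolating field into \<open>H = sin \<theta> U + cos \<theta> V\<close> with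
  independent Gaussian fields \<open>U\<close>, \<open>V\<close>, which is smooth in \<open>\<theta>\<close> up to the endpoints. For smooth \<open>f\<close>
  of at most exponential growth, differentiating \<open>E f(H)\<close> under the expectation and integrating by
  parts against the Gaussian density in each coordinate gives
  \<open>sin \<theta> cos \<theta> \<Sum>\<^sub>a\<^sub>b (E U\<^sub>a U\<^sub>b - E V\<^sub>a V\<^sub>b) E \<partial>\<^sub>a\<partial>\<^sub>b f(H)\<close>. Here the covariance difference factors as
  \<open>(|x||x'| - x\<bullet>x') (|y||y'| - y\<bullet>y')\<close>; it vanishes for \<open>i\<^sub>1 = p\<^sub>1\<close>, so from the Hessian of \<open>Z\<^sup>c\<close> only
  the product of first derivatives in different rows survives. Since \<open>d\<theta>/dt = 1 / (2 sin \<theta> cos \<theta>)\<close>,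
  the derivative in \<open>t\<close> is bounded and extends continuously to \<open>[0, 1]\<close>.
\<close>

section \<open>Gaussian integration by parts\<close>

text \<open>Completing the square turns density times \<open>exp (a * x)\<close> into
  \<open>exp (a\<^sup>2 / 2)\<close> times the normal density with mean a. Since exp (c |x|) is at
  most exp (c x) + exp (-c x), two shifted densities dominate.\<close>

lemma integrable_std_normal_exp_abs:
  "integrable lborel (\<lambda>x. std_normal_density x * exp (c * \<bar>x\<bar>))"
proof (rule Bochner_Integration.integrable_bound)
  have shift: "std_normal_density x * exp (a * x) = exp (a\<^sup>2 / 2) * normal_density a 1 x" for a x :: real
    by (simp add: normal_density_def flip: exp_add)
      (simp add: power2_eq_square field_simps)
  have "integrable lborel (\<lambda>x. exp (c\<^sup>2 / 2) * normal_density c 1 x + exp ((-c)\<^sup>2 / 2) * normal_density (-c) 1 x)"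
    by (intro Bochner_Integration.integrable_add integrable_mult_right integrable_normal_density) auto
  then show "integrable lborel (\<lambda>x. std_normal_density x * exp (c * x) + std_normal_density x * exp ((-c) * x))"
    by (simp only: shift)
  show "AE x in lborel. norm (std_normal_density x * exp (c * \<bar>x\<bar>))
      \<le> norm (std_normal_density x * exp (c * x) + std_normal_density x * exp ((-c) * x))"
  proof (intro AE_I2)
    fix x
    have "exp (c * \<bar>x\<bar>) \<le> exp (c * x) + exp ((-c) * x)"
      by (simp add: abs_if)
    then have "std_normal_density x * exp (c * \<bar>x\<bar>) \<le> std_normal_density x * (exp (c * x) + exp ((-c) * x))"
      by (intro mult_left_mono normal_density_nonneg)
    moreover have "0 \<le> std_normal_density x * exp (c * \<bar>x\<bar>)"
      by simp
    ultimately show "norm (std_normal_density x * exp (c * \<bar>x\<bar>))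
      \<le> norm (std_normal_density x * exp (c * x) + std_normal_density x * exp ((-c) * x))"
      by (simp only: real_norm_def distrib_left abs_of_nonneg)
  qed
qed auto

text \<open>The product of the density with f has derivative density times (f' - x f). Integrate
  this over [-n, n] and let n grow: the Gaussian decay beats the exponential growth of f, so the
  boundary terms vanish.\<close>

lemma std_normal_integral_by_parts:
  fixes f f' :: "real \<Rightarrow> real"
  assumes deriv: "\<And>x. (f has_real_derivative f' x) (at x)"
    and f_le: "\<And>x. \<bar>f x\<bar> \<le> exp (c * (1 + \<bar>x\<bar>))"
    and f'_le: "\<And>x. \<bar>f' x\<bar> \<le> exp (c * (1 + \<bar>x\<bar>))"
    and [measurable]: "f' \<in> borel_measurable borel"
  shows "(LINT x|lborel. std_normal_density x * (x * f x)) = (LINT x|lborel. std_normal_density x * f' x)"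
proof -
  let ?\<phi> = std_normal_density
  have [measurable]: "f \<in> borel_measurable borel"
    using deriv by (intro borel_measurable_continuous_onI continuous_at_imp_continuous_on) (auto intro: DERIV_isCont)
  have int_exp: "integrable lborel (\<lambda>x. exp b * (?\<phi> x * exp (b * \<bar>x\<bar>)))" for b
    by (intro integrable_mult_right integrable_std_normal_exp_abs)
  have int_f': "integrable lborel (\<lambda>x. ?\<phi> x * f' x)"
  proof (rule Bochner_Integration.integrable_bound[OF int_exp[of c]], goal_cases)
    case 2
    show ?case
    proof (intro AE_I2)
      fix x
      have "std_normal_density x * \<bar>f' x\<bar> \<le> std_normal_density x * (exp c * exp (c * \<bar>x\<bar>))"
        using f'_le[of x] by (intro mult_left_mono) (auto simp: distrib_left exp_add)
      then show "norm (std_normal_density x * f' x) \<le> norm (exp c * (std_normal_density x * exp (c * \<bar>x\<bar>)))"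
        by (simp add: abs_mult mult_ac)
    qed
  qed auto
  have int_xf: "integrable lborel (\<lambda>x. ?\<phi> x * (x * f x))"
  proof (rule Bochner_Integration.integrable_bound[OF int_exp[of "c + 1"]], goal_cases)
    case 2
    \<comment> \<open>The factor |x| is absorbed by exp (1 + |x|), which raises the rate from c to c
      + 1.\<close>
    have "\<bar>x\<bar> * \<bar>f x\<bar> \<le> exp (1 + \<bar>x\<bar>) * exp (c * (1 + \<bar>x\<bar>))" for x
      using f_le[of x] exp_ge_add_one_self[of "1 + \<bar>x\<bar>"] by (intro mult_mono) auto
    then have "\<bar>x\<bar> * \<bar>f x\<bar> \<le> exp (c + 1) * exp ((c + 1) * \<bar>x\<bar>)" for x
      by (simp add: algebra_simps flip: exp_add)
    then have "?\<phi> x * (\<bar>x\<bar> * \<bar>f x\<bar>) \<le> ?\<phi> x * (exp (c + 1) * exp ((c + 1) * \<bar>x\<bar>))" for x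
      by (intro mult_left_mono) auto
    then show ?case by (intro AE_I2) (auto simp: abs_mult mult_ac)
  qed auto
  define g' where "g' x = ?\<phi> x * f' x - ?\<phi> x * (x * f x)" for x
  have int_g': "integrable lborel g'"
    unfolding g'_def using int_f' int_xf by auto
  have g_deriv: "((\<lambda>x. ?\<phi> x * f x) has_real_derivative g' x) (at x)" for x
    unfolding std_normal_density_def g'_def
    by (rule derivative_eq_intros deriv refl | simp)+ (simp add: field_simps)
  have FTC: "(LINT x|lborel. indicat_real {-real n..real n} x *\<^sub>R g' x)
      = ?\<phi> (real n) * f (real n) - ?\<phi> (- real n) * f (- real n)" for n
  proof -
    \<comment> \<open>The gauge form of the fundamental theorem allows a discontinuous
      \<open>g'\<close>; its integrability then identifies the value with the Lebesgue
      integral.\<close>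
    have "(g' has_integral (?\<phi> (real n) * f (real n) - ?\<phi> (- real n) * f (- real n))) {-real n..real n}"
      using g_deriv by (intro fundamental_theorem_of_calculus)
        (auto simp flip: has_real_derivative_iff_has_vector_derivative intro: has_field_derivative_at_within)
    moreover have "set_integrable lborel {-real n..real n} g'"
      unfolding set_integrable_def using int_g' by (rule integrable_mult_indicator[rotated]) auto
    ultimately show ?thesis
      by (metis set_borel_integral_eq_integral(2) integral_unique set_lebesgue_integral_def)
  qed
  have "(\<lambda>n. LINT x|lborel. indicat_real {-real n..real n} x *\<^sub>R g' x) \<longlonglongrightarrow> (LINT x|lborel. g' x)"
  proof (rule integral_dominated_convergence)
    show "integrable lborel (\<lambda>x. \<bar>g' x\<bar>)" using int_g' by simp
    show "AE x in lborel. (\<lambda>n. indicat_real {-real n..real n} x *\<^sub>R g' x) \<longlonglongrightarrow> g' x"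
    proof (intro AE_I2 tendsto_eventually)
      fix x :: real
      have "eventually (\<lambda>n. n \<ge> nat \<lceil>\<bar>x\<bar>\<rceil>) sequentially" by (rule eventually_ge_at_top)
      then show "\<forall>\<^sub>F n in sequentially. indicat_real {-real n..real n} x *\<^sub>R g' x = g' x"
        by eventually_elim (auto simp: indicator_def; linarith)
    qed
  qed (auto simp: indicator_def g'_def)
  moreover have "(\<lambda>n. ?\<phi> (real n) * f (real n) - ?\<phi> (- real n) * f (- real n)) \<longlonglongrightarrow> 0"
  proof (rule Lim_null_comparison)
    show "\<forall>\<^sub>F n in sequentially. norm (?\<phi> (real n) * f (real n) - ?\<phi> (- real n) * f (- real n))
        \<le> 2 / sqrt (2 * pi) * exp (c + (c + 1)\<^sup>2 / 2) * exp (- real n)"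
    proof (intro always_eventually allI)
      fix n
      have "\<bar>?\<phi> (real n) * f (real n) - ?\<phi> (- real n) * f (- real n)\<bar>
        \<le> ?\<phi> (real n) * \<bar>f (real n)\<bar> + ?\<phi> (- real n) * \<bar>f (- real n)\<bar>"
        by (rule order_trans[OF abs_triangle_ineq4]) (simp add: abs_mult)
      also have "\<dots> \<le> ?\<phi> (real n) * exp (c * (1 + real n)) + ?\<phi> (- real n) * exp (c * (1 + real n))"
        using f_le[of "real n"] f_le[of "- real n"] by (intro add_mono mult_left_mono) auto
      also have "\<dots> = 2 / sqrt (2 * pi) * exp (c * (1 + real n) - (real n)\<^sup>2 / 2)"
        using exp_add[of "- (real n)\<^sup>2 / 2" "c * (1 + real n)"]
        by (simp add: std_normal_density_def algebra_simps)
      \<comment> \<open>The constant comes from completing the square in c n - n^2 / 2 + n, so that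
        a plain factor exp (-n) remains.\<close>
      also have "\<dots> \<le> 2 / sqrt (2 * pi) * exp (c + (c + 1)\<^sup>2 / 2 - real n)"
      proof (intro mult_left_mono iffD2[OF exp_le_cancel_iff])
        have "c + (c + 1)\<^sup>2 / 2 - real n - (c * (1 + real n) - (real n)\<^sup>2 / 2) = (c + 1 - real n)\<^sup>2 / 2"
          by (simp add: power2_eq_square field_simps)
        then show "c * (1 + real n) - (real n)\<^sup>2 / 2 \<le> c + (c + 1)\<^sup>2 / 2 - real n"
          using zero_le_power2[of "c + 1 - real n"] by linarith
      qed simp
      also have "\<dots> = 2 / sqrt (2 * pi) * exp (c + (c + 1)\<^sup>2 / 2) * exp (- real n)"
        using exp_add[of "c + (c + 1)\<^sup>2 / 2" "- real n"] by simp
      finally show "norm (?\<phi> (real n) * f (real n) - ?\<phi> (- real n) * f (- real n)) \<le> \<dots>" by simp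
    qed
    show "(\<lambda>n. 2 / sqrt (2 * pi) * exp (c + (c + 1)\<^sup>2 / 2) * exp (- real n)) \<longlonglongrightarrow> 0"
      by (intro tendsto_mult_right_zero) real_asymp
  qed
  ultimately have "(LINT x|lborel. g' x) = 0"
    unfolding FTC by (rule LIMSEQ_unique)
  then show ?thesis
    unfolding g'_def using int_f' int_xf by simp
qed

section \<open>Integration by parts for Gaussian vectors\<close>

abbreviation gauss :: "'k set \<Rightarrow> ('k \<Rightarrow> real) measure" where
  "gauss K \<equiv> PiM K (\<lambda>_. std_normal_distribution)"

interpretation gauss_factor: product_prob_space "\<lambda>_. std_normal_distribution" UNIV
  by (intro product_prob_spaceI prob_space_normal_density) simp

text \<open>Growth at most exponential in the l1 norm of the coordinates in I. This class is closed
  under sums, products and linear substitutions, and over a finite index set its measurable members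
  are integrable against the Gaussian product measure.\<close>

definition exp_bounded :: "'a set \<Rightarrow> (('a \<Rightarrow> real) \<Rightarrow> real) \<Rightarrow> bool" where
  "exp_bounded I f \<longleftrightarrow> (\<exists>c\<ge>0. \<forall>v. \<bar>f v\<bar> \<le> exp (c * (1 + (\<Sum>a\<in>I. \<bar>v a\<bar>))))"

text \<open>The exponential of a sum over coordinates factorises, which reduces the claim to one
  dimension.\<close>

lemma integrable_gauss_exp_abs:
  assumes "finite K"
  shows "integrable (gauss K) (\<lambda>g. exp (c * (1 + (\<Sum>k\<in>K. \<bar>g k\<bar>))))"
proof -
  have "integrable (gauss K) (\<lambda>g. \<Prod>k\<in>K. exp (c * \<bar>g k\<bar>))"
    using assms
    by (intro gauss_factor.product_integrable_prod)
      (auto simp: integrable_density intro: integrable_std_normal_exp_abs)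
  then have "integrable (gauss K) (\<lambda>g. exp c * (\<Prod>k\<in>K. exp (c * \<bar>g k\<bar>)))"
    by (rule integrable_mult_right)
  also have "(\<lambda>g. exp c * (\<Prod>k\<in>K. exp (c * \<bar>g k\<bar>))) = (\<lambda>g. exp (c * (1 + (\<Sum>k\<in>K. \<bar>g k\<bar>))))"
    using assms by (simp add: exp_sum exp_add distrib_left sum_distrib_left)
  finally show ?thesis .
qed

lemma integrable_gauss_exp_bounded:
  assumes "finite K" "F \<in> borel_measurable (gauss K)" "exp_bounded K F"
  shows "integrable (gauss K) F"
proof -
  obtain c where "\<And>g. \<bar>F g\<bar> \<le> exp (c * (1 + (\<Sum>k\<in>K. \<bar>g k\<bar>)))"
    using assms(3) unfolding exp_bounded_def by blast
  then show ?thesis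
    by (intro Bochner_Integration.integrable_bound[OF integrable_gauss_exp_abs[OF assms(1), of c] assms(2)]) auto
qed

lemma exp_bounded_component_mult:
  assumes "finite I" "a \<in> I" "exp_bounded I f"
  shows "exp_bounded I (\<lambda>v. v a * f v)"
proof -
  obtain c where c: "c \<ge> 0" "\<And>v. \<bar>f v\<bar> \<le> exp (c * (1 + (\<Sum>a\<in>I. \<bar>v a\<bar>)))"
    using assms(3) unfolding exp_bounded_def by blast
  have "\<bar>v a * f v\<bar> \<le> exp ((c + 1) * (1 + (\<Sum>a\<in>I. \<bar>v a\<bar>)))" for v
  proof -
    have "\<bar>v a\<bar> \<le> (\<Sum>a\<in>I. \<bar>v a\<bar>)"
      using assms by (intro member_le_sum) auto
    then have "\<bar>v a\<bar> \<le> exp (1 + (\<Sum>a\<in>I. \<bar>v a\<bar>))"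
      using exp_ge_add_one_self[of "1 + (\<Sum>a\<in>I. \<bar>v a\<bar>)"] by linarith
    then have "\<bar>v a\<bar> * \<bar>f v\<bar> \<le> exp (1 + (\<Sum>a\<in>I. \<bar>v a\<bar>)) * exp (c * (1 + (\<Sum>a\<in>I. \<bar>v a\<bar>)))"
      using c by (intro mult_mono) auto
    then show ?thesis
      by (simp add: abs_mult algebra_simps flip: exp_add)
  qed
  then show ?thesis
    unfolding exp_bounded_def using c(1) by (intro exI[of _ "c + 1"]) auto
qed

text \<open>Fubini isolates the coordinate k. With the other coordinates frozen, F and F' still grow
  at most exponentially in r, so the one-dimensional formula applies on every slice.\<close>

lemma gauss_integral_by_parts:
  fixes F F' :: "('k \<Rightarrow> real) \<Rightarrow> real"
  assumes "finite K" "k \<in> K"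
    and deriv: "\<And>g r. ((\<lambda>r. F (g(k := r))) has_real_derivative F' (g(k := r))) (at r)"
    and F: "F \<in> borel_measurable (gauss K)" "exp_bounded K F"
    and F': "F' \<in> borel_measurable (gauss K)" "exp_bounded K F'"
  shows "(LINT g|gauss K. g k * F g) = (LINT g|gauss K. F' g)"
proof -
  define J where "J = K - {k}"
  have K: "K = insert k J" "k \<notin> J" "finite J"
    using assms(1,2) by (auto simp: J_def)
  have [measurable]: "F \<in> borel_measurable (gauss (insert k J))" "F' \<in> borel_measurable (gauss (insert k J))"
    using F F' K by auto
  obtain c1 where c1: "c1 \<ge> 0" "\<And>g. \<bar>F g\<bar> \<le> exp (c1 * (1 + (\<Sum>k\<in>K. \<bar>g k\<bar>)))"
    using F(2) unfolding exp_bounded_def by blast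
  obtain c2 where c2: "c2 \<ge> 0" "\<And>g. \<bar>F' g\<bar> \<le> exp (c2 * (1 + (\<Sum>k\<in>K. \<bar>g k\<bar>)))"
    using F'(2) unfolding exp_bounded_def by blast
  have int: "integrable (gauss K) (\<lambda>g. g k * F g)" "integrable (gauss K) F'"
    using assms by (auto intro!: integrable_gauss_exp_bounded exp_bounded_component_mult)
  have slice: "(LINT r|std_normal_distribution. r * F (g(k := r)))
      = (LINT r|std_normal_distribution. F' (g(k := r)))" if g: "g \<in> space (gauss J)" for g
  proof -
    have upd: "(\<lambda>r. g(k := r)) \<in> measurable borel (gauss (insert k J))"
      using g K by (intro measurable_fun_upd[where J=J]) auto
    have m: "(\<lambda>r. F (g(k := r))) \<in> borel_measurable borel" "(\<lambda>r. F' (g(k := r))) \<in> borel_measurable borel"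
      by (auto intro!: measurable_compose[OF upd])
    define S where "S = (\<Sum>j\<in>J. \<bar>g j\<bar>)"
    \<comment> \<open>One rate serves both F and F' on the slice, because 1 + |r| + S is at most (1
      + S) (1 + |r|).\<close>
    define c where "c = max c1 c2 * (1 + S)"
    have "S \<ge> 0" by (simp add: S_def sum_nonneg)
    have sum: "(\<Sum>j\<in>K. \<bar>(g(k := r)) j\<bar>) = \<bar>r\<bar> + S" for r
      using K by (simp add: S_def)(rule sum.cong, auto)
    have scale: "b * (1 + (\<bar>r\<bar> + S)) \<le> c * (1 + \<bar>r\<bar>)" if "b \<ge> 0" "b \<le> max c1 c2" for b r
    proof -
      have "b * (1 + (\<bar>r\<bar> + S)) \<le> max c1 c2 * ((1 + S) * (1 + \<bar>r\<bar>))"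
        using that \<open>S \<ge> 0\<close> by (intro mult_mono) (auto simp: algebra_simps)
      then show ?thesis by (simp add: c_def algebra_simps)
    qed
    have F_le: "\<bar>F (g(k := r))\<bar> \<le> exp (c * (1 + \<bar>r\<bar>))" for r
      using c1(2)[of "g(k := r)"] scale[OF c1(1) max.cobounded1, of r]
      unfolding sum by (rule order_trans[OF _ iffD2[OF exp_le_cancel_iff]])
    have F'_le: "\<bar>F' (g(k := r))\<bar> \<le> exp (c * (1 + \<bar>r\<bar>))" for r
      using c2(2)[of "g(k := r)"] scale[OF c2(1) max.cobounded2, of r]
      unfolding sum by (rule order_trans[OF _ iffD2[OF exp_le_cancel_iff]])
    have "(LINT r|lborel. std_normal_density r * (r * F (g(k := r))))
      = (LINT r|lborel. std_normal_density r * F' (g(k := r)))"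
      by (rule std_normal_integral_by_parts[OF deriv F_le F'_le m(2)])
    then show ?thesis
      using m by (simp add: integral_density)
  qed
  have "(LINT g|gauss K. g k * F g) = (LINT g|gauss J. LINT r|std_normal_distribution. r * F (g(k := r)))"
    using int(1) K unfolding K(1) by (subst gauss_factor.product_integral_insert) auto
  also have "\<dots> = (LINT g|gauss J. LINT r|std_normal_distribution. F' (g(k := r)))"
    by (rule Bochner_Integration.integral_cong[OF refl slice])
  also have "\<dots> = (LINT g|gauss K. F' g)"
    using int(2) K unfolding K(1) by (subst gauss_factor.product_integral_insert) auto
  finally show ?thesis .
qed

section \<open>Gaussian interpolation\<close>

text \<open>The bound B on the derivative holds for all t at once, so by the mean value inequality
  it also bounds every difference quotient. Dominated convergence along an arbitrary null sequence
  then gives the limit.\<close>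

lemma has_real_derivative_integral:
  fixes F F' :: "real \<Rightarrow> 'w \<Rightarrow> real"
  assumes deriv: "\<And>t w. w \<in> space M \<Longrightarrow> ((\<lambda>t. F t w) has_real_derivative F' t w) (at t)"
    and int: "\<And>t. integrable M (F t)"
    and B: "integrable M B" "\<And>t w. w \<in> space M \<Longrightarrow> \<bar>F' t w\<bar> \<le> B w"
    and F': "F' t0 \<in> borel_measurable M"
  shows "((\<lambda>t. LINT w|M. F t w) has_real_derivative (LINT w|M. F' t0 w)) (at t0)"
  unfolding DERIV_def tendsto_at_iff_sequentially
proof (intro allI impI)
  fix X :: "nat \<Rightarrow> real"
  assume X: "\<forall>i. X i \<in> UNIV - {0}" "X \<longlonglongrightarrow> 0"
  have "(\<lambda>i. LINT w|M. (F (t0 + X i) w - F t0 w) / X i) \<longlonglongrightarrow> (LINT w|M. F' t0 w)"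
  proof (rule integral_dominated_convergence[OF F' _ B(1)])
    show "(\<lambda>w. (F (t0 + X i) w - F t0 w) / X i) \<in> borel_measurable M" for i
      using int by (intro borel_measurable_divide borel_measurable_diff) auto
    show "AE w in M. (\<lambda>i. (F (t0 + X i) w - F t0 w) / X i) \<longlonglongrightarrow> F' t0 w"
    proof (intro AE_I2)
      fix w assume "w \<in> space M"
      then have "(\<lambda>h. (F (t0 + h) w - F t0 w) / h) \<midarrow>0\<rightarrow> F' t0 w"
        using deriv unfolding DERIV_def by blast
      then show "(\<lambda>i. (F (t0 + X i) w - F t0 w) / X i) \<longlonglongrightarrow> F' t0 w"
        using X unfolding tendsto_at_iff_sequentially comp_def by blast
    qed
    show "AE w in M. norm ((F (t0 + X i) w - F t0 w) / X i) \<le> B w" for i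
    proof (intro AE_I2)
      fix w assume w: "w \<in> space M"
      have "norm (F (t0 + X i) w - F t0 w) \<le> B w * norm (t0 + X i - t0)"
        using deriv[OF w] B(2)[OF w]
        by (intro field_differentiable_bound[of UNIV _ "\<lambda>t. F' t w"]) (auto intro: has_field_derivative_at_within)
      moreover have "X i \<noteq> 0" using X by auto
      ultimately show "norm ((F (t0 + X i) w - F t0 w) / X i) \<le> B w"
        by (simp add: field_simps)
    qed
  qed
  moreover have "(LINT w|M. (F (t0 + X i) w - F t0 w) / X i)
      = ((LINT w|M. F (t0 + X i) w) - (LINT w|M. F t0 w)) / X i" for i
    using int by simp
  ultimately show "((\<lambda>h. ((LINT w|M. F (t0 + h) w) - (LINT w|M. F t0 w)) / h) \<circ> X) \<longlonglongrightarrow> (LINT w|M. F' t0 w)"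
    by (simp only: comp_def)
qed

lemma isCont_integral:
  fixes F :: "real \<Rightarrow> 'w \<Rightarrow> real"
  assumes cont: "\<And>w. w \<in> space M \<Longrightarrow> isCont (\<lambda>t. F t w) t0"
    and F: "\<And>t. F t \<in> borel_measurable M"
    and B: "integrable M B" "\<And>t w. w \<in> space M \<Longrightarrow> \<bar>F t w\<bar> \<le> B w"
  shows "isCont (\<lambda>t. LINT w|M. F t w) t0"
  unfolding isCont_def tendsto_at_iff_sequentially comp_def
proof (intro allI impI)
  fix X :: "nat \<Rightarrow> real"
  assume X: "\<forall>i. X i \<in> UNIV - {t0}" "X \<longlonglongrightarrow> t0"
  show "(\<lambda>i. LINT w|M. F (X i) w) \<longlonglongrightarrow> (LINT w|M. F t0 w)"
  proof (rule integral_dominated_convergence[OF F F B(1)])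
    show "AE w in M. (\<lambda>i. F (X i) w) \<longlonglongrightarrow> F t0 w"
      using cont X(2) by (intro AE_I2) (auto intro: isCont_tendsto_compose)
  qed (use B in auto)
qed

section \<open>Closure properties of exponentially bounded functions\<close>

lemma exp_bounded_const: "exp_bounded I (\<lambda>v. b)"
proof -
  have "\<bar>b\<bar> \<le> exp (\<bar>b\<bar> * (1 + (\<Sum>a\<in>I. \<bar>v a\<bar>)))" for v :: "'a \<Rightarrow> real"
  proof -
    have "\<bar>b\<bar> \<le> \<bar>b\<bar> * (1 + (\<Sum>a\<in>I. \<bar>v a\<bar>))"
      by (simp add: algebra_simps sum_nonneg)
    also have "\<dots> \<le> exp (\<bar>b\<bar> * (1 + (\<Sum>a\<in>I. \<bar>v a\<bar>)))"
      using exp_ge_add_one_self[of "\<bar>b\<bar> * (1 + (\<Sum>a\<in>I. \<bar>v a\<bar>))"] by linarith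
    finally show ?thesis .
  qed
  then show ?thesis
    unfolding exp_bounded_def by (intro exI[of _ "\<bar>b\<bar>"]) simp
qed

lemma exp_bounded_mult:
  assumes "exp_bounded I f" "exp_bounded I f'"
  shows "exp_bounded I (\<lambda>v. f v * f' v)"
proof -
  obtain c c' where c: "c \<ge> 0" "\<And>v. \<bar>f v\<bar> \<le> exp (c * (1 + (\<Sum>a\<in>I. \<bar>v a\<bar>)))"
    and c': "c' \<ge> 0" "\<And>v. \<bar>f' v\<bar> \<le> exp (c' * (1 + (\<Sum>a\<in>I. \<bar>v a\<bar>)))"
    using assms unfolding exp_bounded_def by blast
  have "\<bar>f v * f' v\<bar> \<le> exp ((c + c') * (1 + (\<Sum>a\<in>I. \<bar>v a\<bar>)))" for v
    unfolding abs_mult distrib_right[of c c'] exp_add by (intro mult_mono c c') auto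
  then show ?thesis
    unfolding exp_bounded_def using c(1) c'(1) by (intro exI[of _ "c + c'"]) auto
qed

lemma exp_bounded_add:
  assumes "exp_bounded I f" "exp_bounded I f'"
  shows "exp_bounded I (\<lambda>v. f v + f' v)"
proof -
  obtain c c' where c: "c \<ge> 0" "\<And>v. \<bar>f v\<bar> \<le> exp (c * (1 + (\<Sum>a\<in>I. \<bar>v a\<bar>)))"
    and c': "c' \<ge> 0" "\<And>v. \<bar>f' v\<bar> \<le> exp (c' * (1 + (\<Sum>a\<in>I. \<bar>v a\<bar>)))"
    using assms unfolding exp_bounded_def by blast
  have "\<bar>f v + f' v\<bar> \<le> exp ((1 + c + c') * (1 + (\<Sum>a\<in>I. \<bar>v a\<bar>)))" for v
  proof -
    define T where "T = 1 + (\<Sum>a\<in>I. \<bar>v a\<bar>)"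
    have "T \<ge> 1" by (simp add: T_def sum_nonneg)
    have "\<bar>f v\<bar> \<le> exp ((c + c') * T)" "\<bar>f' v\<bar> \<le> exp ((c + c') * T)"
      using c c' \<open>T \<ge> 1\<close> unfolding T_def[symmetric]
      by (auto intro!: order_trans[OF c(2)[of v, folded T_def]] order_trans[OF c'(2)[of v, folded T_def]] mult_right_mono)
    then have "\<bar>f v + f' v\<bar> \<le> 2 * exp ((c + c') * T)"
      by linarith
    \<comment> \<open>As T is at least 1, exp T is at least 2 and absorbs the factor 2.\<close>
    also have "\<dots> \<le> exp T * exp ((c + c') * T)"
      using exp_ge_add_one_self[of T] \<open>T \<ge> 1\<close>
      by (intro mult_right_mono) (linarith, simp)
    also have "\<dots> = exp ((1 + c + c') * T)"
      by (simp add: algebra_simps flip: exp_add)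
    finally show ?thesis unfolding T_def .
  qed
  then show ?thesis
    unfolding exp_bounded_def using c(1) c'(1) by (intro exI[of _ "1 + c + c'"]) auto
qed

lemma exp_bounded_sum:
  assumes "\<And>i. i \<in> S \<Longrightarrow> exp_bounded I (f i)"
  shows "exp_bounded I (\<lambda>v. \<Sum>i\<in>S. f i v)"
  using assms
  by (induction S rule: infinite_finite_induct) (auto intro: exp_bounded_const exp_bounded_add)

section \<open>Rotation between two Gaussian fields\<close>

text \<open>A single Gaussian vector g drives both fields: the rows \<open>p a\<close> and
  \<open>q a\<close> hold the coefficients of U and V at the index a. Covariances become inner
  products of rows, and independence of U and V becomes orthogonality of the rows of p to those of
  q.\<close>

definition rotated_field :: "'k set \<Rightarrow> ('a \<Rightarrow> 'k \<Rightarrow> real) \<Rightarrow> ('a \<Rightarrow> 'k \<Rightarrow> real) \<Rightarrow> real \<Rightarrow> ('k \<Rightarrow> real) \<Rightarrow> 'a \<Rightarrow> real"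
  where "rotated_field K p q \<theta> g a = (\<Sum>k\<in>K. (sin \<theta> * p a k + cos \<theta> * q a k) * g k)"

lemma rotated_field_measurable:
  assumes "f \<in> borel_measurable (PiM UNIV (\<lambda>_. borel))"
  shows "(\<lambda>g. f (rotated_field K p q \<theta> g)) \<in> borel_measurable (gauss K)"
proof (rule measurable_compose[OF _ assms])
  show "rotated_field K p q \<theta> \<in> measurable (gauss K) (PiM UNIV (\<lambda>_. borel))"
    unfolding rotated_field_def[abs_def] by (rule measurable_PiM_single') auto
qed

lemma abs_sin_cos_combination_le: "\<bar>sin \<theta> * a + cos \<theta> * b\<bar> \<le> \<bar>a\<bar> + \<bar>b\<bar>" for \<theta> a b :: real
proof -
  have "\<bar>sin \<theta> * a\<bar> \<le> \<bar>a\<bar>" "\<bar>cos \<theta> * b\<bar> \<le> \<bar>b\<bar>"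
    by (auto simp: abs_mult intro: mult_left_le_one_le)
  then show ?thesis by linarith
qed

text \<open>Sine and cosine are at most 1 in absolute value, so the l1 norm of the field is at most
  R times that of g, whatever the angle. The resulting rate does not depend on \<theta>, as
  domination under the expectation requires.\<close>

lemma rotated_field_exp_bound:
  assumes "finite I" "finite K" "exp_bounded I f"
  obtains c where "c \<ge> 0" "\<And>\<theta> g. \<bar>f (rotated_field K p q \<theta> g)\<bar> \<le> exp (c * (1 + (\<Sum>k\<in>K. \<bar>g k\<bar>)))"
proof -
  obtain c where c: "c \<ge> 0" "\<And>v. \<bar>f v\<bar> \<le> exp (c * (1 + (\<Sum>a\<in>I. \<bar>v a\<bar>)))"
    using assms(3) unfolding exp_bounded_def by blast
  define R where "R = (\<Sum>a\<in>I. \<Sum>k\<in>K. \<bar>p a k\<bar> + \<bar>q a k\<bar>)"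
  have R: "R \<ge> 0" by (simp add: R_def sum_nonneg)
  have "(\<Sum>a\<in>I. \<bar>rotated_field K p q \<theta> g a\<bar>) \<le> R * (\<Sum>k\<in>K. \<bar>g k\<bar>)" for \<theta> g
  proof -
    have "\<bar>rotated_field K p q \<theta> g a\<bar> \<le> (\<Sum>k\<in>K. \<bar>p a k\<bar> + \<bar>q a k\<bar>) * (\<Sum>k\<in>K. \<bar>g k\<bar>)" for a
    proof -
      have "\<bar>rotated_field K p q \<theta> g a\<bar> \<le> (\<Sum>k\<in>K. (\<bar>p a k\<bar> + \<bar>q a k\<bar>) * \<bar>g k\<bar>)"
        unfolding rotated_field_def
        by (rule order_trans[OF sum_abs]) (auto simp: abs_mult intro!: sum_mono mult_right_mono abs_sin_cos_combination_le)
      also have "\<dots> \<le> (\<Sum>k\<in>K. (\<bar>p a k\<bar> + \<bar>q a k\<bar>) * (\<Sum>k\<in>K. \<bar>g k\<bar>))"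
        using assms(2) by (intro sum_mono mult_left_mono member_le_sum) auto
      finally show ?thesis by (simp add: sum_distrib_right)
    qed
    then show ?thesis
      unfolding R_def sum_distrib_right[of _ I] by (rule sum_mono)
  qed
  then have "\<bar>f (rotated_field K p q \<theta> g)\<bar> \<le> exp (c * (1 + R * (\<Sum>k\<in>K. \<bar>g k\<bar>)))" for \<theta> g
    using c(1) by (intro order_trans[OF c(2)] iffD2[OF exp_le_cancel_iff] mult_left_mono add_left_mono)
  moreover have "c * (1 + R * (\<Sum>k\<in>K. \<bar>g k\<bar>)) \<le> (c * (1 + R)) * (1 + (\<Sum>k\<in>K. \<bar>g k\<bar>))" for g
  proof -
    have "0 \<le> (\<Sum>k\<in>K. \<bar>g k\<bar>)" by (simp add: sum_nonneg)
    then have "1 + R * (\<Sum>k\<in>K. \<bar>g k\<bar>) \<le> (1 + R) * (1 + (\<Sum>k\<in>K. \<bar>g k\<bar>))"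
      using R by (simp add: algebra_simps)
    then show ?thesis
      unfolding mult.assoc using c(1) by (rule mult_left_mono)
  qed
  ultimately have "\<bar>f (rotated_field K p q \<theta> g)\<bar> \<le> exp ((c * (1 + R)) * (1 + (\<Sum>k\<in>K. \<bar>g k\<bar>)))" for \<theta> g
    by (meson order_trans exp_le_cancel_iff)
  then show ?thesis
    using c(1) R by (intro that[of "c * (1 + R)"]) auto
qed

lemma isCont_expectation_rotated_field:
  assumes "finite I" "finite K" "exp_bounded I f" "f \<in> borel_measurable (PiM UNIV (\<lambda>_. borel))"
    and "\<And>g. isCont (\<lambda>\<theta>. f (rotated_field K p q \<theta> g)) \<theta>"
  shows "isCont (\<lambda>\<theta>. LINT g|gauss K. f (rotated_field K p q \<theta> g)) \<theta>"
proof -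
  obtain c where c: "c \<ge> 0" "\<And>\<theta> g. \<bar>f (rotated_field K p q \<theta> g)\<bar> \<le> exp (c * (1 + (\<Sum>k\<in>K. \<bar>g k\<bar>)))"
    using rotated_field_exp_bound[OF assms(1-3)] by blast
  show ?thesis
    using assms(5) rotated_field_measurable[OF assms(4)] integrable_gauss_exp_abs[OF assms(2)] c(2)
    by (rule isCont_integral)
qed

lemma exp_bounded_rotated_field:
  assumes "finite I" "finite K" "exp_bounded I f"
  shows "exp_bounded K (\<lambda>g. f (rotated_field K p q \<theta> g))"
  using rotated_field_exp_bound[OF assms, of p q] unfolding exp_bounded_def by metis

lemma integrable_rotated_field:
  assumes "finite I" "finite K" "exp_bounded I f" "f \<in> borel_measurable (PiM UNIV (\<lambda>_. borel))"
  shows "integrable (gauss K) (\<lambda>g. f (rotated_field K p q \<theta> g))"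
  using assms
  by (intro integrable_gauss_exp_bounded rotated_field_measurable exp_bounded_rotated_field[where I=I])

text \<open>The D a are partial derivatives, given through the chain rule along curves that are
  differentiable in the coordinates of I. This one form covers both the curve traced by the field as
  \<theta> varies and the one obtained by moving a single coordinate of g.\<close>

definition has_gradient :: "'a set \<Rightarrow> (('a \<Rightarrow> real) \<Rightarrow> real) \<Rightarrow> ('a \<Rightarrow> ('a \<Rightarrow> real) \<Rightarrow> real) \<Rightarrow> bool" where
  "has_gradient I f D \<longleftrightarrow> (\<forall>\<gamma> \<gamma>' r. (\<forall>a\<in>I. ((\<lambda>r. \<gamma> r a) has_real_derivative \<gamma>' a) (at r)) \<longrightarrow>
     ((\<lambda>r. f (\<gamma> r)) has_real_derivative (\<Sum>a\<in>I. D a (\<gamma> r) * \<gamma>' a)) (at r))"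

lemma has_gradientD:
  assumes "has_gradient I f D" "\<And>a. a \<in> I \<Longrightarrow> ((\<lambda>r. \<gamma> r a) has_real_derivative \<gamma>' a) (at r)"
  shows "((\<lambda>r. f (\<gamma> r)) has_real_derivative (\<Sum>a\<in>I. D a (\<gamma> r) * \<gamma>' a)) (at r)"
  using assms unfolding has_gradient_def by blast

text \<open>Differentiation in \<theta> produces a factor g k next to D a; integration by parts
  trades that factor for a second derivative. What multiplies each second derivative is an inner
  product of the rotated row with its own \<theta>-derivative, which orthogonality reduces to the
  covariance difference.\<close>

lemma gaussian_interpolation:
  fixes p q :: "'a \<Rightarrow> 'k \<Rightarrow> real"
  assumes fin: "finite I" "finite K"
    and f: "has_gradient I f D" "exp_bounded I f" "f \<in> borel_measurable (PiM UNIV (\<lambda>_. borel))"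
    and D: "\<And>a. a \<in> I \<Longrightarrow> has_gradient I (D a) (D2 a)" "\<And>a. a \<in> I \<Longrightarrow> exp_bounded I (D a)"
      "\<And>a. a \<in> I \<Longrightarrow> D a \<in> borel_measurable (PiM UNIV (\<lambda>_. borel))"
    and D2: "\<And>a b. a \<in> I \<Longrightarrow> b \<in> I \<Longrightarrow> exp_bounded I (D2 a b)"
      "\<And>a b. a \<in> I \<Longrightarrow> b \<in> I \<Longrightarrow> D2 a b \<in> borel_measurable (PiM UNIV (\<lambda>_. borel))"
    and orth: "\<And>a b. a \<in> I \<Longrightarrow> b \<in> I \<Longrightarrow> (\<Sum>k\<in>K. p a k * q b k) = 0"
  shows "((\<lambda>\<theta>. LINT g|gauss K. f (rotated_field K p q \<theta> g)) has_real_derivative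
      sin \<theta> * cos \<theta> * (\<Sum>a\<in>I. \<Sum>b\<in>I. ((\<Sum>k\<in>K. p a k * p b k) - (\<Sum>k\<in>K. q a k * q b k)) *
        (LINT g|gauss K. D2 a b (rotated_field K p q \<theta> g)))) (at \<theta>)"
proof -
  let ?H = "rotated_field K p q"
  \<comment> \<open>\<open>h \<theta> a k\<close> is the coefficient of g k in the field at a, and
    \<open>w \<theta> a k\<close> is its derivative in \<theta>.\<close>
  define h where "h \<theta> a k = sin \<theta> * p a k + cos \<theta> * q a k" for \<theta> a k
  define w where "w \<theta> a k = cos \<theta> * p a k - sin \<theta> * q a k" for \<theta> a k
  define F' where "F' \<theta> g = (\<Sum>a\<in>I. \<Sum>k\<in>K. w \<theta> a k * (g k * D a (?H \<theta> g)))" for \<theta> g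
  note [measurable] = rotated_field_measurable[OF f(3)] rotated_field_measurable[OF D(3)]
    rotated_field_measurable[OF D2(2)]
  have "\<exists>c. \<forall>\<theta> g. \<bar>D a (?H \<theta> g)\<bar> \<le> exp (c * (1 + (\<Sum>k\<in>K. \<bar>g k\<bar>)))" if "a \<in> I" for a
    using rotated_field_exp_bound[OF fin D(2)[OF that], of p q] by blast
  then obtain c where c: "\<And>a \<theta> g. a \<in> I \<Longrightarrow> \<bar>D a (?H \<theta> g)\<bar> \<le> exp (c a * (1 + (\<Sum>k\<in>K. \<bar>g k\<bar>)))"
    by metis
  \<comment> \<open>A dominating function free of \<theta>. The absolute value of \<open>c a\<close>
    makes the rate nonnegative, as \<open>exp_bounded\<close> demands.\<close>
  define B where "B g = (\<Sum>a\<in>I. \<Sum>k\<in>K. (\<bar>q a k\<bar> + \<bar>p a k\<bar>) * \<bar>g k * exp (\<bar>c a\<bar> * (1 + (\<Sum>k\<in>K. \<bar>g k\<bar>)))\<bar>)" for g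
  have B: "integrable (gauss K) B"
    unfolding B_def
  proof (intro Bochner_Integration.integrable_sum integrable_mult_right integrable_abs)
    fix a k assume "k \<in> K"
    have "exp_bounded K (\<lambda>g. exp (\<bar>c a\<bar> * (1 + (\<Sum>k\<in>K. \<bar>g k\<bar>))))"
      unfolding exp_bounded_def by (intro exI[of _ "\<bar>c a\<bar>"]) simp
    then show "integrable (gauss K) (\<lambda>g. g k * exp (\<bar>c a\<bar> * (1 + (\<Sum>k\<in>K. \<bar>g k\<bar>))))"
      using \<open>k \<in> K\<close> fin
      by (intro integrable_gauss_exp_bounded exp_bounded_component_mult) auto
  qed
  have F'_le: "\<bar>F' \<theta> g\<bar> \<le> B g" for \<theta> g
  proof -
    have "\<bar>w \<theta> a k * (g k * D a (?H \<theta> g))\<bar>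
        \<le> (\<bar>q a k\<bar> + \<bar>p a k\<bar>) * \<bar>g k * exp (\<bar>c a\<bar> * (1 + (\<Sum>k\<in>K. \<bar>g k\<bar>)))\<bar>" if "a \<in> I" for a k
    proof -
      have "exp (c a * (1 + (\<Sum>k\<in>K. \<bar>g k\<bar>))) \<le> exp (\<bar>c a\<bar> * (1 + (\<Sum>k\<in>K. \<bar>g k\<bar>)))"
        by (auto intro!: mult_right_mono add_nonneg_nonneg sum_nonneg)
      then have "\<bar>D a (?H \<theta> g)\<bar> \<le> exp (\<bar>c a\<bar> * (1 + (\<Sum>k\<in>K. \<bar>g k\<bar>)))"
        using c[OF that] order_trans by blast
      moreover have "\<bar>w \<theta> a k\<bar> \<le> \<bar>q a k\<bar> + \<bar>p a k\<bar>"
        using abs_sin_cos_combination_le[of \<theta> "- q a k" "p a k"] by (simp add: w_def)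
      ultimately show ?thesis
        unfolding abs_mult by (intro mult_mono) auto
    qed
    then show ?thesis
      unfolding F'_def B_def
      by (intro order_trans[OF sum_abs] sum_mono order_trans[OF sum_abs])
  qed
  have F'_int: "integrable (gauss K) (\<lambda>g. g k * D a (?H \<theta> g))" if "a \<in> I" "k \<in> K" for a k \<theta>
    using that fin D
    by (intro integrable_gauss_exp_bounded exp_bounded_component_mult exp_bounded_rotated_field[where I=I]) auto
  have "((\<lambda>\<theta>. LINT g|gauss K. f (?H \<theta> g)) has_real_derivative (LINT g|gauss K. F' \<theta> g)) (at \<theta>)"
  proof (rule has_real_derivative_integral[OF _ _ B F'_le])
    fix \<theta> g
    have "((\<lambda>\<theta>. ?H \<theta> g a) has_real_derivative (\<Sum>k\<in>K. w \<theta> a k * g k)) (at \<theta>)" for a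
      unfolding rotated_field_def w_def by (auto intro!: derivative_eq_intros sum.cong)
    then have "((\<lambda>\<theta>. f (?H \<theta> g)) has_real_derivative (\<Sum>a\<in>I. D a (?H \<theta> g) * (\<Sum>k\<in>K. w \<theta> a k * g k))) (at \<theta>)"
      by (rule has_gradientD[OF f(1)])
    also have "(\<Sum>a\<in>I. D a (?H \<theta> g) * (\<Sum>k\<in>K. w \<theta> a k * g k)) = F' \<theta> g"
      unfolding F'_def sum_distrib_left by (simp add: mult_ac)
    finally show "((\<lambda>\<theta>. f (?H \<theta> g)) has_real_derivative F' \<theta> g) (at \<theta>)" .
  next
    show "integrable (gauss K) (\<lambda>g. f (?H \<theta> g))" for \<theta>
      by (rule integrable_rotated_field[OF fin f(2,3)])
    show "F' \<theta> \<in> borel_measurable (gauss K)"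
      unfolding F'_def[abs_def] using F'_int by (intro borel_measurable_sum borel_measurable_times borel_measurable_integrable) auto
  qed
  also have "(LINT g|gauss K. F' \<theta> g) = (\<Sum>a\<in>I. \<Sum>k\<in>K. w \<theta> a k * (LINT g|gauss K. g k * D a (?H \<theta> g)))"
    unfolding F'_def using F'_int by (simp add: Bochner_Integration.integral_sum)
  also have "\<dots> = (\<Sum>a\<in>I. \<Sum>k\<in>K. w \<theta> a k * (\<Sum>b\<in>I. h \<theta> b k * (LINT g|gauss K. D2 a b (?H \<theta> g))))"
  proof (intro sum.cong refl arg_cong2[where f="(*)"])
    fix a k assume a: "a \<in> I" and k: "k \<in> K"
    \<comment> \<open>The field is linear in g, so moving the coordinate k changes the field at b at
      the constant speed \<open>h \<theta> b k\<close>.\<close>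
    have "(LINT g|gauss K. g k * D a (?H \<theta> g)) = (LINT g|gauss K. (\<Sum>b\<in>I. D2 a b (?H \<theta> g) * h \<theta> b k))"
    proof (rule gauss_integral_by_parts[OF fin(2) k])
      fix g :: "'k \<Rightarrow> real" and r
      have "((\<lambda>r. ?H \<theta> (g(k := r)) b) has_real_derivative h \<theta> b k) (at r)" for b
      proof -
        have "((\<lambda>r. (g(k := r)) j) has_real_derivative (if j = k then 1 else 0)) (at r)" for j
          by auto
        then have "((\<lambda>r. ?H \<theta> (g(k := r)) b) has_real_derivative (\<Sum>j\<in>K. h \<theta> b j * (if j = k then 1 else 0))) (at r)"
          unfolding rotated_field_def h_def by (intro DERIV_sum DERIV_cmult)
        then show ?thesis
          using fin k by (simp add: if_distrib cong: if_cong)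
      qed
      then show "((\<lambda>r. D a (?H \<theta> (g(k := r)))) has_real_derivative
          (\<Sum>b\<in>I. D2 a b (?H \<theta> (g(k := r))) * h \<theta> b k)) (at r)"
        by (rule has_gradientD[OF D(1)[OF a]])
    qed (use a fin D D2 in \<open>auto intro!: exp_bounded_rotated_field[where I=I] exp_bounded_sum exp_bounded_mult exp_bounded_const\<close>)
    also have "\<dots> = (\<Sum>b\<in>I. h \<theta> b k * (LINT g|gauss K. D2 a b (?H \<theta> g)))"
      using a integrable_rotated_field[OF fin D2]
      by (subst Bochner_Integration.integral_sum) (auto simp: mult.commute)
    finally show "(LINT g|gauss K. g k * D a (?H \<theta> g)) = \<dots>" .
  qed
  also have "\<dots> = (\<Sum>a\<in>I. \<Sum>b\<in>I. (\<Sum>k\<in>K. w \<theta> a k * h \<theta> b k) * (LINT g|gauss K. D2 a b (?H \<theta> g)))"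
    unfolding sum_distrib_left sum_distrib_right by (subst sum.swap[of _ K I]) (simp add: mult_ac)
  also have "\<dots> = (\<Sum>a\<in>I. \<Sum>b\<in>I. (sin \<theta> * cos \<theta> * ((\<Sum>k\<in>K. p a k * p b k) - (\<Sum>k\<in>K. q a k * q b k)))
      * (LINT g|gauss K. D2 a b (?H \<theta> g)))"
  proof (intro sum.cong refl arg_cong2[where f="(*)"])
    fix a b assume "a \<in> I" "b \<in> I"
    \<comment> \<open>The last two sums are mixed inner products of a row of p with a row of q; both
      vanish by \<open>orth\<close>.\<close>
    have "(\<Sum>k\<in>K. w \<theta> a k * h \<theta> b k) = sin \<theta> * cos \<theta> * (\<Sum>k\<in>K. p a k * p b k) - sin \<theta> * cos \<theta> * (\<Sum>k\<in>K. q a k * q b k)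
       + (cos \<theta>)\<^sup>2 * (\<Sum>k\<in>K. p a k * q b k) - (sin \<theta>)\<^sup>2 * (\<Sum>k\<in>K. p b k * q a k)"
      unfolding sum_distrib_left sum.distrib[symmetric] sum_subtractf[symmetric]
      by (intro sum.cong) (auto simp: w_def h_def power2_eq_square algebra_simps)
    then show "(\<Sum>k\<in>K. w \<theta> a k * h \<theta> b k) = sin \<theta> * cos \<theta> * ((\<Sum>k\<in>K. p a k * p b k) - (\<Sum>k\<in>K. q a k * q b k))"
      using orth \<open>a \<in> I\<close> \<open>b \<in> I\<close> by (simp add: algebra_simps)
  qed
  also have "\<dots> = sin \<theta> * cos \<theta> * (\<Sum>a\<in>I. \<Sum>b\<in>I. ((\<Sum>k\<in>K. p a k * p b k) - (\<Sum>k\<in>K. q a k * q b k)) *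
        (LINT g|gauss K. D2 a b (?H \<theta> g)))"
    by (simp add: sum_distrib_left mult.assoc)
  finally show ?thesis .
qed

section \<open>The lifted partition function\<close>

lemma exp_bounded_if:
  "exp_bounded I f \<Longrightarrow> exp_bounded I f' \<Longrightarrow> exp_bounded I (\<lambda>v. if P then f v else f' v)"
  by (cases P) simp_all

section \<open>Positive functions with logarithm of at most linear growth\<close>

text \<open>In contrast to \<open>exp_bounded\<close> this bounds f from below as well, by a
  decaying exponential. It is therefore stable under negative powers, which occur for Z and the row
  sums in the derivatives below.\<close>

definition log_bounded :: "'a set \<Rightarrow> (('a \<Rightarrow> real) \<Rightarrow> real) \<Rightarrow> bool" where
  "log_bounded I f \<longleftrightarrow> (\<exists>c\<ge>0. \<forall>v. 0 < f v \<and> \<bar>ln (f v)\<bar> \<le> c * (1 + (\<Sum>a\<in>I. \<bar>v a\<bar>)))"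

lemma log_bounded_imp_exp_bounded:
  assumes "log_bounded I f"
  shows "exp_bounded I f"
proof -
  obtain c where c: "c \<ge> 0" "\<And>v. 0 < f v" "\<And>v. \<bar>ln (f v)\<bar> \<le> c * (1 + (\<Sum>a\<in>I. \<bar>v a\<bar>))"
    using assms unfolding log_bounded_def by blast
  have "\<bar>f v\<bar> \<le> exp (c * (1 + (\<Sum>a\<in>I. \<bar>v a\<bar>)))" for v
    using c(2)[of v] abs_le_D1[OF c(3)[of v]] by (subst ln_le_cancel_iff[symmetric]) auto
  then show ?thesis
    unfolding exp_bounded_def using c(1) by blast
qed

lemma log_bounded_exp_component:
  assumes "finite I" "a \<in> I"
  shows "log_bounded I (\<lambda>v. exp (b * v a))"
proof -
  have "\<bar>b * v a\<bar> \<le> \<bar>b\<bar> * (1 + (\<Sum>a\<in>I. \<bar>v a\<bar>))" for v :: "'a \<Rightarrow> real"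
  proof -
    have "\<bar>v a\<bar> \<le> (\<Sum>a\<in>I. \<bar>v a\<bar>)"
      using assms by (intro member_le_sum) auto
    then show ?thesis
      unfolding abs_mult by (intro mult_left_mono) auto
  qed
  then show ?thesis
    unfolding log_bounded_def by (intro exI[of _ "\<bar>b\<bar>"]) auto
qed

lemma log_bounded_powr:
  assumes "log_bounded I f"
  shows "log_bounded I (\<lambda>v. f v powr e)"
proof -
  obtain c where c: "c \<ge> 0" "\<And>v. 0 < f v" "\<And>v. \<bar>ln (f v)\<bar> \<le> c * (1 + (\<Sum>a\<in>I. \<bar>v a\<bar>))"
    using assms unfolding log_bounded_def by blast
  have "\<bar>ln (f v powr e)\<bar> \<le> (\<bar>e\<bar> * c) * (1 + (\<Sum>a\<in>I. \<bar>v a\<bar>))" for v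
    using c(2)[of v] mult_left_mono[OF c(3)[of v], of "\<bar>e\<bar>"] by (simp add: ln_powr abs_mult mult.assoc)
  then show ?thesis
    unfolding log_bounded_def using c by (intro exI[of _ "\<bar>e\<bar> * c"]) (auto simp: less_imp_neq[THEN not_sym])
qed

lemma log_bounded_mult:
  assumes "log_bounded I f" "log_bounded I f'"
  shows "log_bounded I (\<lambda>v. f v * f' v)"
proof -
  obtain c c' where c: "c \<ge> 0" "\<And>v. 0 < f v" "\<And>v. \<bar>ln (f v)\<bar> \<le> c * (1 + (\<Sum>a\<in>I. \<bar>v a\<bar>))"
    and c': "c' \<ge> 0" "\<And>v. 0 < f' v" "\<And>v. \<bar>ln (f' v)\<bar> \<le> c' * (1 + (\<Sum>a\<in>I. \<bar>v a\<bar>))"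
    using assms unfolding log_bounded_def by blast
  have "\<bar>ln (f v * f' v)\<bar> \<le> (c + c') * (1 + (\<Sum>a\<in>I. \<bar>v a\<bar>))" for v
    using c(2,3)[of v] c'(2,3)[of v] by (simp only: ln_mult_pos distrib_right)
  then show ?thesis
    unfolding log_bounded_def using c c' by (intro exI[of _ "c + c'"]) auto
qed

text \<open>From above the logarithm of the sum is controlled by the exponential bound on the sum;
  from below by ln (f v), as f' is positive.\<close>

lemma log_bounded_add:
  assumes "log_bounded I f" "log_bounded I f'"
  shows "log_bounded I (\<lambda>v. f v + f' v)"
proof -
  obtain c c' where c: "c \<ge> 0" "\<And>v. 0 < f v" "\<And>v. \<bar>ln (f v)\<bar> \<le> c * (1 + (\<Sum>a\<in>I. \<bar>v a\<bar>))"
    and c': "c' \<ge> 0" "\<And>v. 0 < f' v" "\<And>v. \<bar>ln (f' v)\<bar> \<le> c' * (1 + (\<Sum>a\<in>I. \<bar>v a\<bar>))"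
    using assms unfolding log_bounded_def by blast
  obtain d where d: "d \<ge> 0" "\<And>v. \<bar>f v + f' v\<bar> \<le> exp (d * (1 + (\<Sum>a\<in>I. \<bar>v a\<bar>)))"
    using exp_bounded_add[OF assms[THEN log_bounded_imp_exp_bounded]] unfolding exp_bounded_def by blast
  have "\<bar>ln (f v + f' v)\<bar> \<le> (c + d) * (1 + (\<Sum>a\<in>I. \<bar>v a\<bar>))" for v
  proof -
    have pos: "0 < f v + f' v" using c(2)[of v] c'(2)[of v] by simp
    then have "ln (f v + f' v) \<le> d * (1 + (\<Sum>a\<in>I. \<bar>v a\<bar>))"
      using d(2)[of v] by (subst ln_exp[symmetric], subst ln_le_cancel_iff) auto
    moreover have "ln (f v) \<le> ln (f v + f' v)"
      using c(2)[of v] c'(2)[of v] by simp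
    moreover have "0 \<le> 1 + (\<Sum>a\<in>I. \<bar>v a\<bar>)"
      by (simp add: add_nonneg_nonneg sum_nonneg)
    then have "0 \<le> c * (1 + (\<Sum>a\<in>I. \<bar>v a\<bar>))" "0 \<le> d * (1 + (\<Sum>a\<in>I. \<bar>v a\<bar>))"
      using c(1) d(1) by simp_all
    ultimately show ?thesis
      using c(3)[of v] unfolding distrib_right[of c d] by linarith
  qed
  then show ?thesis
    unfolding log_bounded_def using c c' d by (intro exI[of _ "c + d"]) (auto intro: add_pos_pos)
qed

lemma log_bounded_sum:
  assumes "finite S" "S \<noteq> {}" "\<And>i. i \<in> S \<Longrightarrow> log_bounded I (f i)"
  shows "log_bounded I (\<lambda>v. \<Sum>i\<in>S. f i v)"
  using assms by (induction S rule: finite_ne_induct) (auto intro: log_bounded_add)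

section \<open>The partition function and its first two derivatives\<close>

text \<open>The field values are now a free vector v indexed by pairs: \<open>row_sum\<close> and
  \<open>lifted_partition\<close> are C and Z as functions of the values of H, so that they can be
  differentiated in v.\<close>

definition row_sum :: "nat \<Rightarrow> real \<Rightarrow> (nat \<times> nat \<Rightarrow> real) \<Rightarrow> nat \<Rightarrow> real" where
  "row_sum l \<beta> v i = (\<Sum>j = 1..l. exp (\<beta> * v (i, j)))"

definition lifted_partition :: "nat \<Rightarrow> real \<Rightarrow> real \<Rightarrow> (nat \<times> nat \<Rightarrow> real) \<Rightarrow> real" where
  "lifted_partition l \<beta> s v = (\<Sum>i = 1..l. row_sum l \<beta> v i powr s)"

text \<open>The partial derivative of Z^c in the coordinate a, whose row is
  \<open>fst a\<close>.\<close>

definition lifted_grad :: "nat \<Rightarrow> real \<Rightarrow> real \<Rightarrow> real \<Rightarrow> nat \<times> nat \<Rightarrow> (nat \<times> nat \<Rightarrow> real) \<Rightarrow> real" where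
  "lifted_grad l \<beta> s c a v = c * s * \<beta> *
     (lifted_partition l \<beta> s v powr (c - 1) * (row_sum l \<beta> v (fst a) powr (s - 1) * exp (\<beta> * v a)))"

text \<open>Up to constants, Z^(c-2) times the product of the partial derivatives of Z at a and b:
  the part of the Hessian that arises from differentiating the outer power twice.\<close>

definition lifted_cross :: "nat \<Rightarrow> real \<Rightarrow> real \<Rightarrow> real \<Rightarrow> nat \<times> nat \<Rightarrow> nat \<times> nat \<Rightarrow> (nat \<times> nat \<Rightarrow> real) \<Rightarrow> real" where
  "lifted_cross l \<beta> s c a b v = lifted_partition l \<beta> s v powr (c - 2) *
     ((row_sum l \<beta> v (fst a) powr (s - 1) * exp (\<beta> * v a)) * (row_sum l \<beta> v (fst b) powr (s - 1) * exp (\<beta> * v b)))"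

text \<open>The three terms come from differentiating the three factors of
  \<open>lifted_grad\<close>: the power of Z, the power of the row sum (only for b in the same row),
  and the exponential (only for b = a).\<close>

definition lifted_hess :: "nat \<Rightarrow> real \<Rightarrow> real \<Rightarrow> real \<Rightarrow> nat \<times> nat \<Rightarrow> nat \<times> nat \<Rightarrow> (nat \<times> nat \<Rightarrow> real) \<Rightarrow> real" where
  "lifted_hess l \<beta> s c a b v =
     c * (c - 1) * s\<^sup>2 * \<beta>\<^sup>2 * lifted_cross l \<beta> s c a b v
     + (if fst a = fst b then
          c * s * \<beta>\<^sup>2 * (s - 1) * (lifted_partition l \<beta> s v powr (c - 1) * (row_sum l \<beta> v (fst a) powr (s - 2)
            * (exp (\<beta> * v a) * exp (\<beta> * v b))))
          + (if a = b then
               c * s * \<beta>\<^sup>2 * (lifted_partition l \<beta> s v powr (c - 1) * (row_sum l \<beta> v (fst a) powr (s - 1) * exp (\<beta> * v a)))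
             else 0)
        else 0)"

lemma row_sum_pos: "l \<ge> 1 \<Longrightarrow> row_sum l \<beta> v i > 0"
  unfolding row_sum_def by (intro sum_pos) auto

lemma lifted_partition_pos: "l \<ge> 1 \<Longrightarrow> lifted_partition l \<beta> s v > 0"
  unfolding lifted_partition_def by (intro sum_pos) (auto simp: less_imp_neq[OF row_sum_pos, THEN not_sym])

lemma row_sum_has_derivative:
  assumes "\<And>j. j \<in> {1..l} \<Longrightarrow> ((\<lambda>r. \<gamma> r (i, j)) has_real_derivative \<gamma>' (i, j)) (at r)"
  shows "((\<lambda>r. row_sum l \<beta> (\<gamma> r) i) has_real_derivative (\<Sum>j = 1..l. \<beta> * exp (\<beta> * \<gamma> r (i, j)) * \<gamma>' (i, j))) (at r)"
  unfolding row_sum_def by (rule DERIV_sum) (auto intro!: derivative_eq_intros assms)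

lemma has_real_derivative_powr_const:
  assumes "(f has_real_derivative f') (at r)" "f r > 0"
  shows "((\<lambda>r. f r powr e) has_real_derivative e * f r powr (e - 1) * f') (at r)"
  using DERIV_fun_powr[OF assms, of e] by simp

lemma lifted_partition_has_derivative:
  assumes "l \<ge> 1"
    and "\<And>i j. i \<in> {1..l} \<Longrightarrow> j \<in> {1..l} \<Longrightarrow> ((\<lambda>r. \<gamma> r (i, j)) has_real_derivative \<gamma>' (i, j)) (at r)"
  shows "((\<lambda>r. lifted_partition l \<beta> s (\<gamma> r)) has_real_derivative
    (\<Sum>i = 1..l. s * row_sum l \<beta> (\<gamma> r) i powr (s - 1) * (\<Sum>j = 1..l. \<beta> * exp (\<beta> * \<gamma> r (i, j)) * \<gamma>' (i, j)))) (at r)"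
  unfolding lifted_partition_def
  by (intro DERIV_sum has_real_derivative_powr_const row_sum_has_derivative row_sum_pos assms)

lemma lifted_partition_has_gradient:
  assumes "l \<ge> 1"
  shows "has_gradient ({1..l} \<times> {1..l}) (\<lambda>v. lifted_partition l \<beta> s v powr c) (lifted_grad l \<beta> s c)"
  unfolding has_gradient_def
proof (intro allI impI)
  fix \<gamma> :: "real \<Rightarrow> nat \<times> nat \<Rightarrow> real" and \<gamma>' r
  assume "\<forall>a\<in>{1..l} \<times> {1..l}. ((\<lambda>r. \<gamma> r a) has_real_derivative \<gamma>' a) (at r)"
  then have "((\<lambda>r. lifted_partition l \<beta> s (\<gamma> r) powr c) has_real_derivative
    c * lifted_partition l \<beta> s (\<gamma> r) powr (c - 1) *
      (\<Sum>i = 1..l. s * row_sum l \<beta> (\<gamma> r) i powr (s - 1) * (\<Sum>j = 1..l. \<beta> * exp (\<beta> * \<gamma> r (i, j)) * \<gamma>' (i, j)))) (at r)"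
    using assms by (intro has_real_derivative_powr_const lifted_partition_has_derivative lifted_partition_pos) auto
  also have "c * lifted_partition l \<beta> s (\<gamma> r) powr (c - 1) *
      (\<Sum>i = 1..l. s * row_sum l \<beta> (\<gamma> r) i powr (s - 1) * (\<Sum>j = 1..l. \<beta> * exp (\<beta> * \<gamma> r (i, j)) * \<gamma>' (i, j)))
    = (\<Sum>a\<in>{1..l} \<times> {1..l}. lifted_grad l \<beta> s c a (\<gamma> r) * \<gamma>' a)"
    unfolding sum_distrib_left sum.cartesian_product
    by (intro sum.cong) (auto simp: lifted_grad_def mult_ac)
  finally show "((\<lambda>r. lifted_partition l \<beta> s (\<gamma> r) powr c) has_real_derivative \<dots>) (at r)" .
qed

lemma lifted_grad_has_gradient:
  assumes "l \<ge> 1" "a \<in> {1..l} \<times> {1..l}"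
  shows "has_gradient ({1..l} \<times> {1..l}) (lifted_grad l \<beta> s c a) (lifted_hess l \<beta> s c a)"
  unfolding has_gradient_def
proof (intro allI impI)
  fix \<gamma> :: "real \<Rightarrow> nat \<times> nat \<Rightarrow> real" and \<gamma>' r
  assume "\<forall>a\<in>{1..l} \<times> {1..l}. ((\<lambda>r. \<gamma> r a) has_real_derivative \<gamma>' a) (at r)"
  then have \<gamma>: "\<And>i j. i \<in> {1..l} \<Longrightarrow> j \<in> {1..l} \<Longrightarrow> ((\<lambda>r. \<gamma> r (i, j)) has_real_derivative \<gamma>' (i, j)) (at r)"
    by auto
  obtain i j where a: "a = (i, j)" and ij: "i \<in> {1..l}" "j \<in> {1..l}"
    using assms(2) by auto
  define A where "A i j = exp (\<beta> * \<gamma> r (i, j))" for i j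
  define C where "C i = row_sum l \<beta> (\<gamma> r) i" for i
  define Z where "Z = lifted_partition l \<beta> s (\<gamma> r)"
  have dZ: "((\<lambda>r. lifted_partition l \<beta> s (\<gamma> r) powr (c - 1)) has_real_derivative
    (c - 1) * Z powr (c - 1 - 1) * (\<Sum>i = 1..l. s * C i powr (s - 1) * (\<Sum>j = 1..l. \<beta> * A i j * \<gamma>' (i, j)))) (at r)"
    unfolding Z_def A_def C_def using assms(1) \<gamma>
    by (intro has_real_derivative_powr_const lifted_partition_has_derivative lifted_partition_pos) auto
  have dC: "((\<lambda>r. row_sum l \<beta> (\<gamma> r) i powr (s - 1)) has_real_derivative
    (s - 1) * C i powr (s - 1 - 1) * (\<Sum>j = 1..l. \<beta> * A i j * \<gamma>' (i, j))) (at r)"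
    unfolding A_def C_def using assms(1) \<gamma> ij
    by (intro has_real_derivative_powr_const row_sum_has_derivative row_sum_pos) auto
  have dA: "((\<lambda>r. exp (\<beta> * \<gamma> r (i, j))) has_real_derivative \<beta> * A i j * \<gamma>' (i, j)) (at r)"
    unfolding A_def by (auto intro!: derivative_eq_intros \<gamma>[OF ij])
  have two: "c - 1 - 1 = c - 2" "s - 1 - 1 = s - 2" by auto
  have "((\<lambda>r. lifted_grad l \<beta> s c a (\<gamma> r)) has_real_derivative
      c * s * \<beta> * ((c - 1) * Z powr (c - 2) * (\<Sum>i = 1..l. s * C i powr (s - 1) * (\<Sum>j = 1..l. \<beta> * A i j * \<gamma>' (i, j)))
          * (C i powr (s - 1) * A i j)
        + (((s - 1) * C i powr (s - 2) * (\<Sum>j = 1..l. \<beta> * A i j * \<gamma>' (i, j))) * A i j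
           + (\<beta> * A i j * \<gamma>' (i, j)) * C i powr (s - 1)) * Z powr (c - 1))) (at r)"
    using DERIV_cmult[OF DERIV_mult[OF dZ DERIV_mult[OF dC dA]], of "c * s * \<beta>"]
    unfolding lifted_grad_def a fst_conv two A_def C_def Z_def .
  also have "c * s * \<beta> * ((c - 1) * Z powr (c - 2) * (\<Sum>i = 1..l. s * C i powr (s - 1) * (\<Sum>j = 1..l. \<beta> * A i j * \<gamma>' (i, j)))
          * (C i powr (s - 1) * A i j)
        + (((s - 1) * C i powr (s - 2) * (\<Sum>j = 1..l. \<beta> * A i j * \<gamma>' (i, j))) * A i j
           + (\<beta> * A i j * \<gamma>' (i, j)) * C i powr (s - 1)) * Z powr (c - 1))
    = (\<Sum>p = 1..l. \<Sum>q = 1..l. c * (c - 1) * s\<^sup>2 * \<beta>\<^sup>2 * (Z powr (c - 2) * ((C i powr (s - 1) * A i j) * (C p powr (s - 1) * A p q))) * \<gamma>' (p, q))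
      + (\<Sum>q = 1..l. c * s * \<beta>\<^sup>2 * (s - 1) * (Z powr (c - 1) * (C i powr (s - 2) * (A i j * A i q))) * \<gamma>' (i, q))
      + c * s * \<beta>\<^sup>2 * (Z powr (c - 1) * (C i powr (s - 1) * A i j)) * \<gamma>' (i, j)"
    by (simp add: sum_distrib_left sum_distrib_right distrib_left distrib_right power2_eq_square mult_ac)
  \<comment> \<open>The sum over one row and the single term are written as full double sums with
    indicators, so that all three parts can be compared with \<open>lifted_hess\<close> term by
    term. The deletion of \<open>sum.delta\<close> below keeps these indicators from collapsing
    again.\<close>
  also have "\<dots> = (\<Sum>p = 1..l. \<Sum>q = 1..l. c * (c - 1) * s\<^sup>2 * \<beta>\<^sup>2 * (Z powr (c - 2) * ((C i powr (s - 1) * A i j) * (C p powr (s - 1) * A p q))) * \<gamma>' (p, q))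
      + (\<Sum>p = 1..l. if i = p then \<Sum>q = 1..l. c * s * \<beta>\<^sup>2 * (s - 1) * (Z powr (c - 1) * (C i powr (s - 2) * (A i j * A p q))) * \<gamma>' (p, q) else 0)
      + (\<Sum>p = 1..l. if i = p then \<Sum>q = 1..l. if j = q then c * s * \<beta>\<^sup>2 * (Z powr (c - 1) * (C i powr (s - 1) * A i j)) * \<gamma>' (p, q) else 0 else 0)"
    using ij by simp
  also have "\<dots> = (\<Sum>b\<in>{1..l} \<times> {1..l}. lifted_hess l \<beta> s c a b (\<gamma> r) * \<gamma>' b)"
    unfolding sum.cartesian_product[symmetric, of "\<lambda>p q. lifted_hess l \<beta> s c a (p, q) (\<gamma> r) * \<gamma>' (p, q)", simplified]
      sum.distrib[symmetric]
    by (intro sum.cong refl)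
      (auto simp: a lifted_hess_def lifted_cross_def A_def C_def Z_def distrib_right sum.distrib[symmetric]
        simp del: sum.delta sum.delta' intro!: sum.cong)
  finally show "((\<lambda>r. lifted_grad l \<beta> s c a (\<gamma> r)) has_real_derivative \<dots>) (at r)" .
qed

section \<open>Growth, measurability and continuity of the derivatives\<close>

lemma row_sum_log_bounded:
  assumes "l \<ge> 1" "i \<in> {1..l}"
  shows "log_bounded ({1..l} \<times> {1..l}) (\<lambda>v. row_sum l \<beta> v i)"
  unfolding row_sum_def using assms by (intro log_bounded_sum log_bounded_exp_component) auto

lemma lifted_partition_log_bounded:
  assumes "l \<ge> 1"
  shows "log_bounded ({1..l} \<times> {1..l}) (lifted_partition l \<beta> s)"
  unfolding lifted_partition_def[abs_def]
  using assms by (intro log_bounded_sum log_bounded_powr row_sum_log_bounded) auto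

lemma lifted_partition_exp_bounded:
  assumes "l \<ge> 1"
  shows "exp_bounded ({1..l} \<times> {1..l}) (\<lambda>v. lifted_partition l \<beta> s v powr c)"
  using assms by (intro log_bounded_imp_exp_bounded log_bounded_powr lifted_partition_log_bounded)

lemma lifted_grad_exp_bounded:
  assumes "l \<ge> 1" "a \<in> {1..l} \<times> {1..l}"
  shows "exp_bounded ({1..l} \<times> {1..l}) (lifted_grad l \<beta> s c a)"
  unfolding lifted_grad_def[abs_def] using assms
  by (intro exp_bounded_mult exp_bounded_const log_bounded_imp_exp_bounded log_bounded_powr
      lifted_partition_log_bounded row_sum_log_bounded log_bounded_exp_component) auto

lemma lifted_cross_exp_bounded:
  assumes "l \<ge> 1" "a \<in> {1..l} \<times> {1..l}" "b \<in> {1..l} \<times> {1..l}"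
  shows "exp_bounded ({1..l} \<times> {1..l}) (lifted_cross l \<beta> s c a b)"
  unfolding lifted_cross_def[abs_def] using assms
  by (intro log_bounded_imp_exp_bounded log_bounded_mult log_bounded_powr
      lifted_partition_log_bounded row_sum_log_bounded log_bounded_exp_component) auto

lemma lifted_hess_exp_bounded:
  assumes "l \<ge> 1" "a \<in> {1..l} \<times> {1..l}" "b \<in> {1..l} \<times> {1..l}"
  shows "exp_bounded ({1..l} \<times> {1..l}) (lifted_hess l \<beta> s c a b)"
proof -
  have row: "exp_bounded ({1..l} \<times> {1..l}) (\<lambda>v. k * (lifted_partition l \<beta> s v powr (c - 1) *
      (row_sum l \<beta> v (fst a) powr (s - 2) * (exp (\<beta> * v a) * exp (\<beta> * v b)))))" for k
    using assms
    by (intro exp_bounded_mult exp_bounded_const log_bounded_imp_exp_bounded log_bounded_powr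
      lifted_partition_log_bounded row_sum_log_bounded log_bounded_exp_component) auto
  have diag: "exp_bounded ({1..l} \<times> {1..l}) (\<lambda>v. k * (lifted_partition l \<beta> s v powr (c - 1) *
      (row_sum l \<beta> v (fst a) powr (s - 1) * exp (\<beta> * v a))))" for k
    using assms
    by (intro exp_bounded_mult exp_bounded_const log_bounded_imp_exp_bounded log_bounded_powr
      lifted_partition_log_bounded row_sum_log_bounded log_bounded_exp_component) auto
  have cross: "exp_bounded ({1..l} \<times> {1..l}) (\<lambda>v. k * lifted_cross l \<beta> s c a b v)" for k
    using assms by (intro exp_bounded_mult exp_bounded_const lifted_cross_exp_bounded)
  show ?thesis
    unfolding lifted_hess_def[abs_def] by (intro exp_bounded_add exp_bounded_if exp_bounded_const row diag cross)
qed

lemma row_sum_measurable [measurable]: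
  "(\<lambda>v. row_sum l \<beta> v i) \<in> borel_measurable (PiM UNIV (\<lambda>_. borel))"
  unfolding row_sum_def by measurable

lemma lifted_partition_measurable [measurable]:
  "lifted_partition l \<beta> s \<in> borel_measurable (PiM UNIV (\<lambda>_. borel))"
  unfolding lifted_partition_def[abs_def] by measurable

lemma lifted_grad_measurable:
  "lifted_grad l \<beta> s c a \<in> borel_measurable (PiM UNIV (\<lambda>_. borel))"
  unfolding lifted_grad_def[abs_def] by measurable

lemma lifted_cross_measurable [measurable]:
  "lifted_cross l \<beta> s c a b \<in> borel_measurable (PiM UNIV (\<lambda>_. borel))"
  unfolding lifted_cross_def[abs_def] by measurable

lemma lifted_hess_measurable:
  "lifted_hess l \<beta> s c a b \<in> borel_measurable (PiM UNIV (\<lambda>_. borel))"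
  unfolding lifted_hess_def[abs_def] by measurable

lemma isCont_lifted_cross:
  fixes \<gamma> :: "real \<Rightarrow> nat \<times> nat \<Rightarrow> real"
  assumes "l \<ge> 1" "\<And>a. isCont (\<lambda>r. \<gamma> r a) r"
  shows "isCont (\<lambda>r. lifted_cross l \<beta> s c a b (\<gamma> r)) r"
proof -
  have row: "isCont (\<lambda>r. row_sum l \<beta> (\<gamma> r) i) r" for i
    unfolding row_sum_def by (intro continuous_sum continuous_exp continuous_mult continuous_const assms(2))
  have row_powr: "isCont (\<lambda>r. row_sum l \<beta> (\<gamma> r) i powr e) r" for i e
    using tendsto_powr[OF row[of i, unfolded isCont_def] tendsto_const, of e] row_sum_pos[OF assms(1), of \<beta> "\<gamma> r" i]
    unfolding isCont_def by simp
  have partition: "isCont (\<lambda>r. lifted_partition l \<beta> s (\<gamma> r)) r"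
    unfolding lifted_partition_def by (intro continuous_sum row_powr)
  have partition_powr: "isCont (\<lambda>r. lifted_partition l \<beta> s (\<gamma> r) powr e) r" for e
    using tendsto_powr[OF partition[unfolded isCont_def] tendsto_const, of e]
      lifted_partition_pos[OF assms(1), of \<beta> s "\<gamma> r"]
    unfolding isCont_def by simp
  show ?thesis
    unfolding lifted_cross_def
    by (intro continuous_mult partition_powr row_powr continuous_exp continuous_const assms(2))
qed

section \<open>The interpolated expectation\<close>

lemma UNIV_coord:
  "(UNIV :: ('m, 'n) coord set) = (\<lambda>(i, j). Coord_G i j) ` UNIV \<union> {Coord_u4} \<union> range Coord_u2 \<union> range Coord_h"
proof -
  have "k \<in> (\<lambda>(i, j). Coord_G i j) ` UNIV \<union> {Coord_u4} \<union> range Coord_u2 \<union> range Coord_h" for k :: "('m, 'n) coord"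
    by (cases k) (auto simp: image_iff)
  then show ?thesis by blast
qed

lemma finite_UNIV_coord: "finite (UNIV :: ('m::finite, 'n::finite) coord set)"
  unfolding UNIV_coord by simp

lemma sum_coord:
  fixes f :: "('m::finite, 'n::finite) coord \<Rightarrow> 'b::comm_monoid_add"
  shows "(\<Sum>k\<in>UNIV. f k) = (\<Sum>i\<in>UNIV. \<Sum>j\<in>UNIV. f (Coord_G i j)) + f Coord_u4
    + (\<Sum>i\<in>UNIV. f (Coord_u2 i)) + (\<Sum>j\<in>UNIV. f (Coord_h j))"
proof -
  let ?G = "(\<lambda>(i, j). Coord_G i j) ` UNIV :: ('m, 'n) coord set"
  have "sum f UNIV = sum f (?G \<union> {Coord_u4} \<union> range Coord_u2) + sum f (range Coord_h)"
    unfolding UNIV_coord by (rule sum.union_disjoint) auto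
  also have "sum f (?G \<union> {Coord_u4} \<union> range Coord_u2) = sum f (?G \<union> {Coord_u4}) + sum f (range Coord_u2)"
    by (rule sum.union_disjoint) auto
  also have "sum f (?G \<union> {Coord_u4}) = sum f ?G + sum f {Coord_u4}"
    by (rule sum.union_disjoint) auto
  finally have "sum f UNIV = sum f ?G + f Coord_u4 + sum f (range Coord_u2) + sum f (range Coord_h)"
    by simp
  moreover have "sum f ((\<lambda>(i, j). Coord_G i j) ` UNIV) = (\<Sum>i\<in>UNIV. \<Sum>j\<in>UNIV. f (Coord_G i j))"
    by (subst sum.reindex) (auto simp: inj_on_def sum.cartesian_product comp_def split_def)
  moreover have "sum f (range Coord_u2) = (\<Sum>i\<in>UNIV. f (Coord_u2 i))"
    "sum f (range Coord_h) = (\<Sum>j\<in>UNIV. f (Coord_h j))"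
    by (subst sum.reindex; simp add: inj_on_def)+
  ultimately show ?thesis by simp
qed

text \<open>The field U, made of the terms of H that carry sqrt t, in the coordinates of (G, u4, u2,
  h). An index a is the pair (i1, i2): \<open>fst a\<close> selects x and \<open>snd a\<close>
  selects y.\<close>

fun sqrt_t_coeff :: "(nat \<Rightarrow> real^'n) \<Rightarrow> (nat \<Rightarrow> real^'m) \<Rightarrow> nat \<times> nat \<Rightarrow> ('m::finite, 'n::finite) coord \<Rightarrow> real" where
  "sqrt_t_coeff x y a (Coord_G i j) = y (snd a) $ i * x (fst a) $ j"
| "sqrt_t_coeff x y a Coord_u4 = norm (x (fst a)) * norm (y (snd a))"
| "sqrt_t_coeff x y a (Coord_u2 i) = 0"
| "sqrt_t_coeff x y a (Coord_h j) = 0"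

fun sqrt_1_minus_t_coeff :: "(nat \<Rightarrow> real^'n) \<Rightarrow> (nat \<Rightarrow> real^'m) \<Rightarrow> nat \<times> nat \<Rightarrow> ('m::finite, 'n::finite) coord \<Rightarrow> real" where
  "sqrt_1_minus_t_coeff x y a (Coord_G i j) = 0"
| "sqrt_1_minus_t_coeff x y a Coord_u4 = 0"
| "sqrt_1_minus_t_coeff x y a (Coord_u2 i) = norm (x (fst a)) * y (snd a) $ i"
| "sqrt_1_minus_t_coeff x y a (Coord_h j) = norm (y (snd a)) * x (fst a) $ j"

text \<open>The two fields use disjoint blocks of coordinates: G and u4 for one, u2 and h for the
  other.\<close>

lemma coeff_orthogonal: "(\<Sum>k\<in>UNIV. sqrt_t_coeff x y a k * sqrt_1_minus_t_coeff x y b k) = 0"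
  by (simp add: sum_coord)

text \<open>With x, y belonging to a and x', y' to b, the first covariance is (x.x')(y.y') +
  |x||x'||y||y'| and the second is |x||x'|(y.y') + |y||y'|(x.x'). Their difference factors; the u4
  term supplies the product of norms that makes this possible.\<close>

lemma coeff_covariance_diff:
  "(\<Sum>k\<in>UNIV. sqrt_t_coeff x y a k * sqrt_t_coeff x y b k)
     - (\<Sum>k\<in>UNIV. sqrt_1_minus_t_coeff x y a k * sqrt_1_minus_t_coeff x y b k)
   = (norm (x (fst a)) * norm (x (fst b)) - x (fst a) \<bullet> x (fst b))
     * (norm (y (snd a)) * norm (y (snd b)) - y (snd a) \<bullet> y (snd b))"
proof -
  have "(\<Sum>i\<in>UNIV. \<Sum>j\<in>UNIV. (y (snd a) $ i * x (fst a) $ j) * (y (snd b) $ i * x (fst b) $ j))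
      = (y (snd a) \<bullet> y (snd b)) * (x (fst a) \<bullet> x (fst b))"
    unfolding inner_vec_def sum_product by (simp add: mult_ac)
  moreover have "(\<Sum>i\<in>UNIV. (norm (x (fst a)) * y (snd a) $ i) * (norm (x (fst b)) * y (snd b) $ i))
      = norm (x (fst a)) * norm (x (fst b)) * (y (snd a) \<bullet> y (snd b))"
    unfolding inner_vec_def by (simp add: sum_distrib_left mult_ac)
  moreover have "(\<Sum>j\<in>UNIV. (norm (y (snd a)) * x (fst a) $ j) * (norm (y (snd b)) * x (fst b) $ j))
      = norm (y (snd a)) * norm (y (snd b)) * (x (fst a) \<bullet> x (fst b))"
    unfolding inner_vec_def by (simp add: sum_distrib_left mult_ac)
  ultimately show ?thesis
    by (simp add: sum_coord algebra_simps)
qed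

lemma
  fixes t :: real
  assumes "0 \<le> t" "t \<le> 1"
  shows sin_arcsin_sqrt: "sin (arcsin (sqrt t)) = sqrt t"
    and cos_arcsin_sqrt: "cos (arcsin (sqrt t)) = sqrt (1 - t)"
  using assms by (intro sin_arcsin, auto intro: order_trans[of _ 0])
    (subst cos_arcsin, auto intro: order_trans[of _ 0])

lemma H_interp_eq_rotated_field:
  assumes "0 \<le> t" "t \<le> 1"
  shows "H_interp x y (G \<omega>) (u4 \<omega>) (u2 \<omega>) (h \<omega>) t (fst a) (snd a)
    = rotated_field UNIV (sqrt_t_coeff x y) (sqrt_1_minus_t_coeff x y) (arcsin (sqrt t)) (\<lambda>k. entry G u4 u2 h k \<omega>) a"
  unfolding H_interp_def rotated_field_def sum_coord sin_arcsin_sqrt[OF assms] cos_arcsin_sqrt[OF assms]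
  by (simp add: inner_vec_def matrix_vector_mult_def sum_distrib_left mult_ac)

text \<open>The form in which \<open>overlap_sum\<close> emerges from the interpolation formula: a
  function of the field values, summed over pairs of index pairs and weighted by the covariance
  difference.\<close>

definition overlap_form :: "nat \<Rightarrow> (nat \<Rightarrow> real^'n) \<Rightarrow> (nat \<Rightarrow> real^'m) \<Rightarrow> real \<Rightarrow> real \<Rightarrow> real \<Rightarrow> (nat \<times> nat \<Rightarrow> real) \<Rightarrow> real" where
  "overlap_form l x y \<beta> s c v = (\<Sum>a\<in>{1..l} \<times> {1..l}. \<Sum>b\<in>{1..l} \<times> {1..l}.
     ((norm (x (fst a)) * norm (x (fst b)) - x (fst a) \<bullet> x (fst b))
       * (norm (y (snd a)) * norm (y (snd b)) - y (snd a) \<bullet> y (snd b))) * lifted_cross l \<beta> s c a b v)"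

lemma Z_interp_eq:
  assumes "\<And>a. v a = H_interp x y G u4 u2 h t (fst a) (snd a)"
  shows "Z_interp l x y \<beta> s G u4 u2 h t = lifted_partition l \<beta> s v"
  by (simp add: Z_interp_def C_interp_def A_interp_def lifted_partition_def row_sum_def assms)

text \<open>As C and Z are positive, C^s / C = C^(s-1) and 1 / Z^(2-c) = Z^(c-2), so the summands
  agree. Exchanging the sums over p and j then groups the four indices into a = (i, j) and b = (p,
  q).\<close>

lemma overlap_sum_eq:
  assumes "l \<ge> 1" and v: "\<And>a. v a = H_interp x y G u4 u2 h t (fst a) (snd a)"
  shows "overlap_sum l x y \<beta> s c G u4 u2 h t = overlap_form l x y \<beta> s c v"
proof -
  define A where "A i j = exp (\<beta> * v (i, j))" for i j
  define C where "C i = row_sum l \<beta> v i" for i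
  define Z where "Z = lifted_partition l \<beta> s v"
  define X where "X i p = norm (x i) * norm (x p) - x i \<bullet> x p" for i p
  define Y where "Y j q = norm (y j) * norm (y q) - y j \<bullet> y q" for j q
  have A_eq: "A_interp x y \<beta> G u4 u2 h t = A"
    by (simp add: fun_eq_iff A_def A_interp_def v)
  have C_eq: "C_interp l x y \<beta> G u4 u2 h t = C"
    by (simp add: fun_eq_iff C_def C_interp_def A_eq row_sum_def A_def)
  have Z_eq: "Z_interp l x y \<beta> s G u4 u2 h t = Z"
    unfolding Z_def by (rule Z_interp_eq[OF v])
  have C_pos: "C i > 0" for i unfolding C_def by (rule row_sum_pos[OF assms(1)])
  have "Z > 0" unfolding Z_def by (rule lifted_partition_pos[OF assms(1)])
  then have Z_powr: "1 / Z powr (2 - c) = Z powr (c - 2)"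
    using powr_minus_divide[of Z "2 - c"] by simp
  have C_powr: "C i powr (s - 1) = C i powr s / C i" for i
    using C_pos[of i] by (simp add: powr_diff)
  have summand: "C i powr s * C p powr s * X i p / Z powr (2 - c) * (A i j * A p q / (C i * C p) * Y j q)
      = (X i p * Y j q) * (Z powr (c - 2) * ((C i powr (s - 1) * A i j) * (C p powr (s - 1) * A p q)))" for i j p q
    unfolding Z_powr[symmetric] C_powr by simp
  have "overlap_sum l x y \<beta> s c G u4 u2 h t
    = (\<Sum>i = 1..l. \<Sum>p = 1..l. \<Sum>j = 1..l. \<Sum>q = 1..l.
        C i powr s * C p powr s * X i p / Z powr (2 - c) * (A i j * A p q / (C i * C p) * Y j q))"
    unfolding overlap_sum_def Let_def A_eq C_eq Z_eq X_def[symmetric] Y_def[symmetric] sum_distrib_left ..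
  also have "\<dots> = (\<Sum>i = 1..l. \<Sum>p = 1..l. \<Sum>j = 1..l. \<Sum>q = 1..l.
        (X i p * Y j q) * (Z powr (c - 2) * ((C i powr (s - 1) * A i j) * (C p powr (s - 1) * A p q))))"
    unfolding summand ..
  also have "\<dots> = (\<Sum>i = 1..l. \<Sum>j = 1..l. \<Sum>p = 1..l. \<Sum>q = 1..l.
        (X i p * Y j q) * (Z powr (c - 2) * ((C i powr (s - 1) * A i j) * (C p powr (s - 1) * A p q))))"
    by (intro sum.cong refl sum.swap)
  also have "\<dots> = overlap_form l x y \<beta> s c v"
    unfolding overlap_form_def lifted_cross_def sum.cartesian_product' X_def Y_def A_def C_def Z_def
    by simp
  finally show ?thesis .
qed

text \<open>The covariance factor of a pair \<open>a, b\<close> vanishes when \<open>fst a = fst b\<close>, so only the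
  cross terms of the Hessian survive.\<close>

lemma sum_covariance_hess:
  "(\<Sum>a\<in>{1..l} \<times> {1..l}. \<Sum>b\<in>{1..l} \<times> {1..l}.
     ((norm (x (fst a)) * norm (x (fst b)) - x (fst a) \<bullet> x (fst b))
       * (norm (y (snd a)) * norm (y (snd b)) - y (snd a) \<bullet> y (snd b))) * lifted_hess l \<beta> s c a b v)
   = c * (c - 1) * s\<^sup>2 * \<beta>\<^sup>2 * overlap_form l x y \<beta> s c v"
  unfolding overlap_form_def sum_distrib_left
proof (intro sum.cong refl)
  fix a b :: "nat \<times> nat"
  show "((norm (x (fst a)) * norm (x (fst b)) - x (fst a) \<bullet> x (fst b))
       * (norm (y (snd a)) * norm (y (snd b)) - y (snd a) \<bullet> y (snd b))) * lifted_hess l \<beta> s c a b v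
    = c * (c - 1) * s\<^sup>2 * \<beta>\<^sup>2 * (((norm (x (fst a)) * norm (x (fst b)) - x (fst a) \<bullet> x (fst b))
       * (norm (y (snd a)) * norm (y (snd b)) - y (snd a) \<bullet> y (snd b))) * lifted_cross l \<beta> s c a b v)"
  proof (cases "fst a = fst b")
    case True
    then have "norm (x (fst a)) * norm (x (fst b)) - x (fst a) \<bullet> x (fst b) = 0"
      by (simp add: dot_square_norm power2_eq_square)
    then show ?thesis by simp
  next
    case False
    then show ?thesis by (simp add: lifted_hess_def)
  qed
qed

lemma overlap_form_exp_bounded:
  assumes "l \<ge> 1"
  shows "exp_bounded ({1..l} \<times> {1..l}) (overlap_form l x y \<beta> s c)"
  unfolding overlap_form_def[abs_def] using assms
  by (intro exp_bounded_sum exp_bounded_mult[OF exp_bounded_const] lifted_cross_exp_bounded)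

lemma overlap_form_measurable:
  "overlap_form l x y \<beta> s c \<in> borel_measurable (PiM UNIV (\<lambda>_. borel))"
  unfolding overlap_form_def[abs_def] by measurable

section \<open>Transfer to the canonical Gaussian space\<close>

text \<open>Independence together with the marginals determines the joint law, so expectations over
  M can be computed on the Gaussian product space.\<close>

lemma distr_entry:
  assumes "iid_std_normal M G u4 u2 h"
  shows "distr M (PiM UNIV (\<lambda>_. borel)) (\<lambda>\<omega> k. entry G u4 u2 h k \<omega>) = gauss UNIV"
proof -
  interpret prob_space M using assms by (simp add: iid_std_normal_def)
  have dist: "distributed M lborel (entry G u4 u2 h k) std_normal_density" for k
    using assms by (simp add: iid_std_normal_def)
  have rv: "random_variable borel (entry G u4 u2 h k)" for k
    using distributed_measurable[OF dist] by simp
  have "distr M (PiM UNIV (\<lambda>_. borel)) (\<lambda>\<omega>. \<lambda>k\<in>UNIV. entry G u4 u2 h k \<omega>)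
      = PiM UNIV (\<lambda>k. distr M borel (entry G u4 u2 h k))"
    using assms rv by (subst indep_vars_iff_distr_eq_PiM[symmetric]) (auto simp: iid_std_normal_def)
  moreover have "distr M borel (entry G u4 u2 h k) = std_normal_distribution" for k
    using distributed_distr_eq_density[OF dist, of k] by (simp cong: distr_cong)
  ultimately show ?thesis by (simp add: restrict_def)
qed

lemma
  fixes F :: "(('m::finite, 'n::finite) coord \<Rightarrow> real) \<Rightarrow> real"
  assumes iid: "iid_std_normal M G u4 u2 h" and F: "F \<in> borel_measurable (gauss UNIV)"
  shows integral_entry: "(LINT \<omega>|M. F (\<lambda>k. entry G u4 u2 h k \<omega>)) = (LINT g|gauss UNIV. F g)"
    and integrable_entry: "integrable M (\<lambda>\<omega>. F (\<lambda>k. entry G u4 u2 h k \<omega>)) \<longleftrightarrow> integrable (gauss UNIV) F"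
proof -
  have "entry G u4 u2 h k \<in> borel_measurable M" for k
    using iid distributed_measurable[of M lborel "entry G u4 u2 h k"] by (auto simp: iid_std_normal_def)
  then have meas: "(\<lambda>\<omega> k. entry G u4 u2 h k \<omega>) \<in> measurable M (PiM UNIV (\<lambda>_. borel))"
    by (intro measurable_PiM_single') auto
  \<comment> \<open>The factors carry the Borel sets, so measurability for \<open>gauss UNIV\<close>
    is measurability for the Borel product on which the law of the entries is formed.\<close>
  have "sets (gauss UNIV :: (('m, 'n) coord \<Rightarrow> real) measure) = sets (PiM UNIV (\<lambda>_. borel))"
    by (intro sets_PiM_cong) auto
  then have F': "F \<in> borel_measurable (PiM UNIV (\<lambda>_. borel))"
    using F by (simp cong: measurable_cong_sets)
  show "(LINT \<omega>|M. F (\<lambda>k. entry G u4 u2 h k \<omega>)) = (LINT g|gauss UNIV. F g)"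
    unfolding distr_entry[OF iid, symmetric] by (rule integral_distr[OF meas F', symmetric])
  show "integrable M (\<lambda>\<omega>. F (\<lambda>k. entry G u4 u2 h k \<omega>)) \<longleftrightarrow> integrable (gauss UNIV) F"
    unfolding distr_entry[OF iid, symmetric] by (rule integrable_distr_eq[OF meas F', symmetric])
qed

lemma interpolated_expectation_has_derivative:
  fixes x :: "nat \<Rightarrow> real^'n" and y :: "nat \<Rightarrow> real^'m"
  assumes "l \<ge> 1"
  defines "H \<equiv> rotated_field UNIV (sqrt_t_coeff x y) (sqrt_1_minus_t_coeff x y)"
  shows "((\<lambda>\<theta>. LINT g|gauss UNIV. lifted_partition l \<beta> s (H \<theta> g) powr c) has_real_derivative
    sin \<theta> * cos \<theta> * (c * (c - 1) * s\<^sup>2 * \<beta>\<^sup>2 * (LINT g|gauss UNIV. overlap_form l x y \<beta> s c (H \<theta> g)))) (at \<theta>)"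
proof -
  let ?I = "{1..l} \<times> {1..l}"
  define T where "T a b = (norm (x (fst a)) * norm (x (fst b)) - x (fst a) \<bullet> x (fst b))
       * (norm (y (snd a)) * norm (y (snd b)) - y (snd a) \<bullet> y (snd b))" for a b :: "nat \<times> nat"
  have "((\<lambda>\<theta>. LINT g|gauss UNIV. lifted_partition l \<beta> s (H \<theta> g) powr c) has_real_derivative
    sin \<theta> * cos \<theta> * (\<Sum>a\<in>?I. \<Sum>b\<in>?I. T a b * (LINT g|gauss UNIV. lifted_hess l \<beta> s c a b (H \<theta> g)))) (at \<theta>)"
    unfolding H_def T_def coeff_covariance_diff[symmetric]
    by (rule gaussian_interpolation[OF _ finite_UNIV_coord lifted_partition_has_gradient
          lifted_partition_exp_bounded _ lifted_grad_has_gradient lifted_grad_exp_bounded lifted_grad_measurable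
          lifted_hess_exp_bounded lifted_hess_measurable coeff_orthogonal])
      (use assms(1) in auto)
  \<comment> \<open>The sums move inside the expectation because \<open>sum_covariance_hess\<close>,
    which removes the same-row terms, is a pointwise identity.\<close>
  also have "(\<Sum>a\<in>?I. \<Sum>b\<in>?I. T a b * (LINT g|gauss UNIV. lifted_hess l \<beta> s c a b (H \<theta> g)))
    = (LINT g|gauss UNIV. (\<Sum>a\<in>?I. \<Sum>b\<in>?I. T a b * lifted_hess l \<beta> s c a b (H \<theta> g)))"
  proof -
    have int: "integrable (gauss UNIV) (\<lambda>g. lifted_hess l \<beta> s c a b (H \<theta> g))" if "a \<in> ?I" "b \<in> ?I" for a b
      unfolding H_def using that assms(1)
      by (intro integrable_rotated_field[OF _ finite_UNIV_coord lifted_hess_exp_bounded lifted_hess_measurable]) auto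
    have "(LINT g|gauss UNIV. (\<Sum>a\<in>?I. \<Sum>b\<in>?I. T a b * lifted_hess l \<beta> s c a b (H \<theta> g)))
      = (\<Sum>a\<in>?I. LINT g|gauss UNIV. (\<Sum>b\<in>?I. T a b * lifted_hess l \<beta> s c a b (H \<theta> g)))"
      by (intro Bochner_Integration.integral_sum Bochner_Integration.integrable_sum integrable_mult_right int)
    also have "\<dots> = (\<Sum>a\<in>?I. \<Sum>b\<in>?I. LINT g|gauss UNIV. T a b * lifted_hess l \<beta> s c a b (H \<theta> g))"
      by (intro sum.cong refl Bochner_Integration.integral_sum integrable_mult_right int)
    finally show ?thesis by simp
  qed
  also have "\<dots> = c * (c - 1) * s\<^sup>2 * \<beta>\<^sup>2 * (LINT g|gauss UNIV. overlap_form l x y \<beta> s c (H \<theta> g))"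
    unfolding T_def sum_covariance_hess by simp
  finally show ?thesis .
qed

section \<open>Return from the angle to the parameter t\<close>

lemma has_real_derivative_arcsin_sqrt:
  assumes "0 < t" "t < 1"
  shows "((\<lambda>t. arcsin (sqrt t)) has_real_derivative 1 / (2 * sqrt t * sqrt (1 - t))) (at t)"
proof -
  have "((\<lambda>t. arcsin (sqrt t)) has_real_derivative inverse (sqrt (1 - (sqrt t)\<^sup>2)) * (inverse (sqrt t) / 2)) (at t)"
    using assms by (intro DERIV_chain2[OF DERIV_arcsin DERIV_real_sqrt]) (auto intro: less_trans[of _ 0])
  then show ?thesis
    using assms by (simp add: field_simps)
qed

theorem theorem2:
  fixes M :: "'w measure"
    and G :: "'w \<Rightarrow> real^'n^'m" and u4 :: "'w \<Rightarrow> real"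
    and u2 :: "'w \<Rightarrow> real^'m" and h :: "'w \<Rightarrow> real^'n"
    and l :: nat and x :: "nat \<Rightarrow> real^'n" and y :: "nat \<Rightarrow> real^'m"
    and \<beta> s c3 :: real
  assumes "iid_std_normal M G u4 u2 h"
    and "l \<ge> 1" and "\<beta> > 0" and "c3 > 0"
  defines "\<psi> \<equiv> psi_star M G u4 u2 h l x y \<beta> s c3"
  shows
    "(\<forall>t\<in>{0..1}.
        integrable M (\<lambda>\<omega>. Z_interp l x y \<beta> s (G \<omega>) (u4 \<omega>) (u2 \<omega>) (h \<omega>) t powr c3)
        \<and> interval_lebesgue_integrable lborel 0 t (deriv \<psi>)
        \<and> \<psi> t = \<psi> 0 + (LBINT \<tau>=0..t. deriv \<psi> \<tau>))
     \<and> (\<forall>\<tau>\<in>{0<..<1}.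
        integrable M (\<lambda>\<omega>. overlap_sum l x y \<beta> s c3 (G \<omega>) (u4 \<omega>) (u2 \<omega>) (h \<omega>) \<tau>)
        \<and> (\<psi> has_real_derivative
             - (s\<^sup>2 * \<beta>\<^sup>2 * c3 * (1 - c3) / 2)
             * (LINT \<omega>|M. overlap_sum l x y \<beta> s c3 (G \<omega>) (u4 \<omega>) (u2 \<omega>) (h \<omega>) \<tau>)) (at \<tau>))"
proof -
  define H where "H = rotated_field UNIV (sqrt_t_coeff x y) (sqrt_1_minus_t_coeff x y)"
  define \<Psi> where "\<Psi> \<theta> = (LINT g|gauss UNIV. lifted_partition l \<beta> s (H \<theta> g) powr c3)" for \<theta>
  define E where "E \<theta> = (LINT g|gauss UNIV. overlap_form l x y \<beta> s c3 (H \<theta> g))" for \<theta>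
  define angle :: "real \<Rightarrow> real" where "angle t = arcsin (sqrt t)" for t
  \<comment> \<open>The candidate derivative makes sense on all of [0, 1], including the endpoints,
    where nothing is claimed about \<open>deriv \<psi>\<close>.\<close>
  define D where "D t = - (s\<^sup>2 * \<beta>\<^sup>2 * c3 * (1 - c3) / 2) * E (angle t)" for t
  note iid = assms(1) and l = assms(2)
  have H: "H (angle t) (\<lambda>k. entry G u4 u2 h k \<omega>) a = H_interp x y (G \<omega>) (u4 \<omega>) (u2 \<omega>) (h \<omega>) t (fst a) (snd a)"
    if "t \<in> {0..1}" for t \<omega> a
    unfolding H_def angle_def using that by (intro H_interp_eq_rotated_field[symmetric]) auto
  have Z: "Z_interp l x y \<beta> s (G \<omega>) (u4 \<omega>) (u2 \<omega>) (h \<omega>) t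
      = lifted_partition l \<beta> s (H (angle t) (\<lambda>k. entry G u4 u2 h k \<omega>))" if "t \<in> {0..1}" for t \<omega>
    by (rule Z_interp_eq[OF H[OF that]])
  have overlap: "overlap_sum l x y \<beta> s c3 (G \<omega>) (u4 \<omega>) (u2 \<omega>) (h \<omega>) t
      = overlap_form l x y \<beta> s c3 (H (angle t) (\<lambda>k. entry G u4 u2 h k \<omega>))" if "t \<in> {0..1}" for t \<omega>
    by (rule overlap_sum_eq[OF l H[OF that]])
  have Z_powr_measurable: "(\<lambda>v. lifted_partition l \<beta> s v powr c3) \<in> borel_measurable (PiM UNIV (\<lambda>_. borel))"
    by measurable
  have finI: "finite ({1..l} \<times> {1..l})" by simp
  have transfer: "integrable M (\<lambda>\<omega>. f (H \<theta> (\<lambda>k. entry G u4 u2 h k \<omega>)))"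
      "(LINT \<omega>|M. f (H \<theta> (\<lambda>k. entry G u4 u2 h k \<omega>))) = (LINT g|gauss UNIV. f (H \<theta> g))"
    if bounded: "exp_bounded ({1..l} \<times> {1..l}) f" and f: "f \<in> borel_measurable (PiM UNIV (\<lambda>_. borel))" for f \<theta>
  proof -
    have "(\<lambda>g. f (H \<theta> g)) \<in> borel_measurable (gauss UNIV)" "integrable (gauss UNIV) (\<lambda>g. f (H \<theta> g))"
      unfolding H_def by (rule rotated_field_measurable[OF f], rule integrable_rotated_field[OF finI finite_UNIV_coord bounded f])
    then show "integrable M (\<lambda>\<omega>. f (H \<theta> (\<lambda>k. entry G u4 u2 h k \<omega>)))"
      "(LINT \<omega>|M. f (H \<theta> (\<lambda>k. entry G u4 u2 h k \<omega>))) = (LINT g|gauss UNIV. f (H \<theta> g))"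
      using integral_entry[OF iid, of "\<lambda>g. f (H \<theta> g)"] integrable_entry[OF iid, of "\<lambda>g. f (H \<theta> g)"]
      by blast+
  qed
  note Z_transfer = transfer[OF lifted_partition_exp_bounded[OF l] Z_powr_measurable]
  note overlap_transfer = transfer[OF overlap_form_exp_bounded[OF l] overlap_form_measurable]
  have int_Z: "integrable M (\<lambda>\<omega>. Z_interp l x y \<beta> s (G \<omega>) (u4 \<omega>) (u2 \<omega>) (h \<omega>) t powr c3)"
    and \<psi>_eq: "\<psi> t = \<Psi> (angle t)" if "t \<in> {0..1}" for t
    unfolding \<psi>_def psi_star_def Z[OF that] \<Psi>_def by (rule Z_transfer)+
  have int_overlap: "integrable M (\<lambda>\<omega>. overlap_sum l x y \<beta> s c3 (G \<omega>) (u4 \<omega>) (u2 \<omega>) (h \<omega>) t)"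
    and overlap_eq: "(LINT \<omega>|M. overlap_sum l x y \<beta> s c3 (G \<omega>) (u4 \<omega>) (u2 \<omega>) (h \<omega>) t) = E (angle t)"
    if "t \<in> {0..1}" for t
    unfolding overlap[OF that] E_def by (rule overlap_transfer)+
  have \<Psi>_deriv: "(\<Psi> has_real_derivative
      sin \<theta> * cos \<theta> * (c3 * (c3 - 1) * s\<^sup>2 * \<beta>\<^sup>2 * E \<theta>)) (at \<theta>)" for \<theta>
    unfolding \<Psi>_def E_def H_def by (rule interpolated_expectation_has_derivative[OF l])
  have angle_cont: "continuous_on {0..1} angle"
    unfolding angle_def[abs_def] by (intro continuous_intros) (auto intro: order_trans[of _ 0])
  have E_cont: "isCont E \<theta>" for \<theta>
    unfolding E_def H_def
  proof (rule isCont_expectation_rotated_field[OF finI finite_UNIV_coord overlap_form_exp_bounded[OF l] overlap_form_measurable])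
    show "isCont (\<lambda>\<theta>. overlap_form l x y \<beta> s c3
        (rotated_field UNIV (sqrt_t_coeff x y) (sqrt_1_minus_t_coeff x y) \<theta> g)) \<theta>" for g
      unfolding overlap_form_def
      by (intro continuous_sum continuous_mult continuous_const isCont_lifted_cross[OF l])
        (auto simp: rotated_field_def intro!: continuous_intros)
  qed
  have D_cont: "continuous_on {0..1} D"
    unfolding D_def[abs_def]
    by (intro continuous_on_mult continuous_on_const
        continuous_on_compose2[OF continuous_at_imp_continuous_on angle_cont subset_refl, of E])
      (simp add: E_cont)
  have \<psi>_cont: "continuous_on {0..1} \<psi>"
  proof -
    have "continuous_on {0..1} (\<lambda>t. \<Psi> (angle t))"
      by (intro continuous_on_compose2[OF continuous_at_imp_continuous_on angle_cont subset_refl, of \<Psi>]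
          ballI DERIV_isCont[OF \<Psi>_deriv])
    then show ?thesis
      by (rule continuous_on_cong[THEN iffD1, rotated 2]) (simp_all add: \<psi>_eq)
  qed
  have \<psi>_deriv: "(\<psi> has_real_derivative D t) (at t)" if t: "t \<in> {0<..<1}" for t
  proof -
    have chain: "((\<lambda>t. \<Psi> (angle t)) has_real_derivative
        sin (angle t) * cos (angle t) * (c3 * (c3 - 1) * s\<^sup>2 * \<beta>\<^sup>2 * E (angle t)) * (1 / (2 * sqrt t * sqrt (1 - t)))) (at t)"
      using t by (intro DERIV_chain2[OF \<Psi>_deriv]) (auto simp: angle_def intro: has_real_derivative_arcsin_sqrt)
    have trig: "sin (angle t) = sqrt t" "cos (angle t) = sqrt (1 - t)"
      unfolding angle_def using t by (simp_all add: sin_arcsin_sqrt cos_arcsin_sqrt)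
    \<comment> \<open>The vanishing factor sin \<theta> cos \<theta> cancels the singular
      d\<theta>/dt and leaves the 1/2 of the final constant.\<close>
    have cancel: "sqrt t * sqrt (1 - t) * e * (1 / (2 * sqrt t * sqrt (1 - t))) = e / 2" for e
      using t by simp
    have "((\<lambda>t. \<Psi> (angle t)) has_real_derivative c3 * (c3 - 1) * s\<^sup>2 * \<beta>\<^sup>2 * E (angle t) / 2) (at t)"
      using chain unfolding trig cancel .
    also have "c3 * (c3 - 1) * s\<^sup>2 * \<beta>\<^sup>2 * E (angle t) / 2 = D t"
      by (simp add: D_def field_simps)
    finally have "((\<lambda>t. \<Psi> (angle t)) has_real_derivative D t) (at t)" .
    \<comment> \<open>\<open>\<psi>\<close> agrees with the composition only on [0, 1], where sine
      and cosine of the angle are the two square roots; an open neighbourhood inside suffices for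
      the derivative.\<close>
    then show ?thesis
      by (rule has_field_derivative_transform_within_open[of _ _ _ "{0<..<1}"]) (use t in \<open>auto simp: \<psi>_eq\<close>)
  qed
  have FTC: "interval_lebesgue_integrable lborel 0 t (deriv \<psi>) \<and> \<psi> t = \<psi> 0 + (LBINT \<tau>=0..t. deriv \<psi> \<tau>)"
    if t: "t \<in> {0..1}" for t
  proof -
    have sub: "{0..t} \<subseteq> {0..1}" using t by auto
    have D_int: "set_integrable lborel {0..t} D"
      by (rule borel_integrable_atLeastAtMost'[OF continuous_on_subset[OF D_cont sub]])
    \<comment> \<open>The interval integral runs over the open interval, so the values of
      \<open>deriv \<psi>\<close> at 0 and t do not enter.\<close>
    have deriv_eq: "deriv \<psi> \<tau> = D \<tau>" if "\<tau> \<in> einterval 0 t" for \<tau>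
      using that t by (intro DERIV_imp_deriv \<psi>_deriv) (auto simp: einterval_iff zero_ereal_def)
    have "set_integrable lborel (einterval 0 t) D"
      by (rule set_integrable_subset[OF D_int]) (auto simp: einterval_iff zero_ereal_def)
    then have int: "interval_lebesgue_integrable lborel 0 t (deriv \<psi>)"
      using t deriv_eq by (simp add: interval_lebesgue_integrable_def cong: set_integrable_cong)
    \<comment> \<open>This version of the fundamental theorem asks for the derivative in the
      interior and continuity up to the boundary, which is what \<open>\<psi>_deriv\<close> and
      \<open>\<psi>_cont\<close> provide.\<close>
    have "(D has_integral (\<psi> t - \<psi> 0)) {0..t}"
      using t by (intro fundamental_theorem_of_calculus_interior continuous_on_subset[OF \<psi>_cont sub])
        (auto simp flip: has_real_derivative_iff_has_vector_derivative intro!: \<psi>_deriv)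
    then have "(LINT \<tau>:{0..t}|lborel. D \<tau>) = \<psi> t - \<psi> 0"
      using set_borel_integral_eq_integral(2)[OF D_int] by (simp add: integral_unique)
    moreover have "(LBINT \<tau>=ereal 0..ereal t. D \<tau>) = (LINT \<tau>:{0..t}|lborel. D \<tau>)"
      using t by (intro interval_integral_Icc) simp
    moreover have "(LBINT \<tau>=0..t. deriv \<psi> \<tau>) = (LBINT \<tau>=ereal 0..ereal t. D \<tau>)"
      unfolding zero_ereal_def[symmetric] using t deriv_eq
      by (intro interval_integral_cong) (simp add: min_def max_def)
    ultimately have "\<psi> t = \<psi> 0 + (LBINT \<tau>=0..t. deriv \<psi> \<tau>)"
      by linarith
    with int show ?thesis by simp
  qed
  show ?thesis
  proof (intro conjI ballI)
    fix t :: real assume t: "t \<in> {0..1}"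
    show "integrable M (\<lambda>\<omega>. Z_interp l x y \<beta> s (G \<omega>) (u4 \<omega>) (u2 \<omega>) (h \<omega>) t powr c3)"
      by (rule int_Z[OF t])
    show "interval_lebesgue_integrable lborel 0 t (deriv \<psi>)" "\<psi> t = \<psi> 0 + (LBINT \<tau>=0..t. deriv \<psi> \<tau>)"
      using FTC[OF t] by blast+
  next
    fix \<tau> :: real assume \<tau>: "\<tau> \<in> {0<..<1}"
    then have "\<tau> \<in> {0..1}" by auto
    then show "integrable M (\<lambda>\<omega>. overlap_sum l x y \<beta> s c3 (G \<omega>) (u4 \<omega>) (u2 \<omega>) (h \<omega>) \<tau>)"
      by (rule int_overlap)
    show "(\<psi> has_real_derivative - (s\<^sup>2 * \<beta>\<^sup>2 * c3 * (1 - c3) / 2)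
             * (LINT \<omega>|M. overlap_sum l x y \<beta> s c3 (G \<omega>) (u4 \<omega>) (u2 \<omega>) (h \<omega>) \<tau>)) (at \<tau>)"
      using \<psi>_deriv[OF \<tau>] unfolding overlap_eq[OF \<open>\<tau> \<in> {0..1}\<close>] D_def .
  qed
qed

end
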